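(* Let $p:\mathbb{R}^2\to\mathbb{R}$ be a non-constant polynomial with $x\cdot\nabla p(x)\le 0$ for all $x\in\mathbb{R}^2$. Then there is no function $u\in C^\infty(\mathbb{R}^2)$ satisfying $$-\Delta u=p(x)e^{2u}\quad\text{on }\mathbb{R}^2,$$ with $u\le C$ on $\mathbb{R}^2$ for some constant $C\in\mathbb{R}$, and such that $$\int_{\mathbb{R}^2}|p(x)|e^{2u(x)}\,\mathrm{d}x<\infty.$$
   Context: $u$ is real-valued, and $\Delta=\partial_{x_1}^2+\partial_{x_2}^2$ is the Euclidean Laplacian. The integral condition is the finite total curvature condition for the metric $e^{2u}g_{\mathbb{R}^2}$, where $g_{\mathbb{R}^2}$ is the flat metric. *)

theory Defs
  imports "HOL-Analysis.Analysis"
begin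

definition partial_deriv :: "'n \<Rightarrow> (real ^ 'n \<Rightarrow> real) \<Rightarrow> real ^ 'n \<Rightarrow> real"
  where "partial_deriv i f x = deriv (\<lambda>t. f (x + t *\<^sub>R axis i 1)) 0"

definition grad :: "(real ^ 'n \<Rightarrow> real) \<Rightarrow> real ^ 'n \<Rightarrow> real ^ 'n"
  where "grad f x = (\<chi> i. partial_deriv i f x)"

definition laplacian :: "(real ^ 'n \<Rightarrow> real) \<Rightarrow> real ^ 'n \<Rightarrow> real"
  where "laplacian f x = (\<Sum>i\<in>UNIV. partial_deriv i (partial_deriv i f) x)"

(* The differentiability requirement matters: deriv is total, so
   regularity of the partial_deriv functions alone would not say that
   the partial derivatives exist. *)
primrec Ck :: "nat \<Rightarrow> (real ^ 'n \<Rightarrow> real) \<Rightarrow> bool" where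
  "Ck 0 f \<longleftrightarrow> continuous_on UNIV f"
| "Ck (Suc k) f \<longleftrightarrow> f differentiable_on UNIV \<and> (\<forall>i. Ck k (partial_deriv i f))"

definition smooth :: "(real ^ 'n \<Rightarrow> real) \<Rightarrow> bool"
  where "smooth f \<longleftrightarrow> (\<forall>k. Ck k f)"

end

theory Submission
  imports Defs "HOL-Computational_Algebra.Polynomial"
begin

text \<open>In cylindrical coordinates \<open>x = exp t (cos \<theta>, sin \<theta>)\<close> the equation becomes
\<open>U\<^sub>t\<^sub>t + U\<^sub>\<theta>\<^sub>\<theta> = - g\<close> with \<open>g = exp (2 t) p exp (2 U)\<close>, where \<open>g\<close> has finite mass on \<open>t \<ge> 0\<close>.

Let \<open>m t\<close> be the mean of \<open>U\<close> over the circle and \<open>V = U - m\<close>. The function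
\<open>\<Phi> = \<integral> V arctan V d\<theta>\<close> grows at most linearly, because \<open>U\<close> is bounded above and \<open>m\<close> decreases
at most linearly, while \<open>\<Phi>''\<close> dominates \<open>\<integral> U\<^sub>\<theta>\<^sup>2 / (1 + V\<^sup>2)\<^sup>2 d\<theta>\<close> up to an integrable error.
Hence at arbitrarily late times \<open>U\<close> is almost radial: \<open>\<bar>V\<bar> \<le> 1\<close> and \<open>\<integral> U\<^sub>\<theta>\<^sup>2 d\<theta>\<close> is small.

The Pohozaev quantity \<open>\<integral> (U\<^sub>t\<^sup>2 - U\<^sub>\<theta>\<^sup>2 + g + 2 U\<^sub>t) d\<theta>\<close> has derivative
\<open>\<integral> exp (2 t) (x \<bullet> grad p) exp (2 U) d\<theta> \<le> 0\<close> and vanishes as \<open>t\<close> tends to \<open>-\<infinity>\<close>, so it is eventually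
at most a negative constant. Evaluated at the almost radial times this forces \<open>m' \<ge> -2 + \<epsilon>\<close>
for all late \<open>t\<close>. But the mean of \<open>\<bar>p\<bar>\<close> over circles grows at least like \<open>exp (2 t)\<close>, so at
the almost radial times \<open>\<integral> \<bar>g\<bar> d\<theta>\<close> is at least of order \<open>exp (2 t + 2 m + 2 t)\<close>, which is unbounded;
yet it is small there.\<close>

section \<open>Integrals over circles\<close>

text \<open>Joint continuity is put in the case-product form in which
  \<open>leibniz_rule_field_derivative\<close> and \<open>integral_continuous_on_param\<close> ask
  for it.\<close>

definition jcont :: "(real \<Rightarrow> real \<Rightarrow> real) \<Rightarrow> bool"
  where "jcont f \<longleftrightarrow> continuous_on UNIV (\<lambda>(t, \<theta>). f t \<theta>)"

lemma jcontI: "continuous_on UNIV (\<lambda>z. f (fst z) (snd z)) \<Longrightarrow> jcont f"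
  by (simp add: jcont_def case_prod_unfold)

text \<open>Instantiated at each jointly continuous function, this supplies the rules by which
  \<open>continuous_intros\<close> later handles composite integrands.\<close>

lemma jcont_compose:
  assumes "jcont f" "continuous_on S a" "continuous_on S b"
  shows "continuous_on S (\<lambda>x. f (a x) (b x))"
proof -
  have "continuous_on UNIV (\<lambda>z. f (fst z) (snd z))"
    using assms(1) by (simp add: jcont_def case_prod_unfold)
  from continuous_on_compose2[OF this continuous_on_Pair[OF assms(2,3)]] show ?thesis
    by simp
qed

definition cint :: "(real \<Rightarrow> real \<Rightarrow> real) \<Rightarrow> real \<Rightarrow> real"
  where "cint f t = integral {0..2*pi} (f t)"

lemma jcont_slice: "jcont f \<Longrightarrow> continuous_on S (f t)"
  by (rule jcont_compose[of f S "\<lambda>_. t" "\<lambda>x. x"]) (auto intro: continuous_intros)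

lemma jcont_integrable: "jcont f \<Longrightarrow> f t integrable_on {a..b}"
  by (intro integrable_continuous_real jcont_slice)

lemma cint_has_derivative:
  assumes "\<And>t \<theta>. ((\<lambda>t. f t \<theta>) has_real_derivative f' t \<theta>) (at t)" "jcont f" "jcont f'"
  shows "(cint f has_real_derivative cint f' t) (at t)"
proof -
  have "((\<lambda>x. integral (cbox 0 (2*pi)) (f x)) has_real_derivative integral (cbox 0 (2*pi)) (f' t)) (at t within UNIV)"
    using assms
    by (intro leibniz_rule_field_derivative)
       (auto simp: jcont_integrable jcont_def intro: continuous_on_subset)
  thus ?thesis by (simp add: cint_def[abs_def])
qed

lemma cint_continuous [continuous_intros]:
  assumes "jcont f" shows "continuous_on S (cint f)"
proof -
  have "continuous_on S (\<lambda>x. integral (cbox 0 (2*pi)) (f x))"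
    using assms by (intro integral_continuous_on_param)
       (auto simp: jcont_def intro: continuous_on_subset)
  thus ?thesis by (simp add: cint_def[abs_def])
qed

lemma cint_add: "jcont f \<Longrightarrow> jcont g \<Longrightarrow> cint (\<lambda>t \<theta>. f t \<theta> + g t \<theta>) t = cint f t + cint g t"
  by (simp add: cint_def integral_add jcont_integrable)

lemma cint_diff: "jcont f \<Longrightarrow> jcont g \<Longrightarrow> cint (\<lambda>t \<theta>. f t \<theta> - g t \<theta>) t = cint f t - cint g t"
  by (simp add: cint_def integral_diff jcont_integrable)

lemma cint_cmult: "cint (\<lambda>t \<theta>. c t * f t \<theta>) t = c t * cint f t"
  by (simp add: cint_def)

lemma cint_const: "cint (\<lambda>t \<theta>. c t) t = 2 * pi * c t"
  by (simp add: cint_def)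

lemma cint_mono:
  assumes "jcont f" "jcont g" "\<And>\<theta>. \<theta> \<in> {0..2*pi} \<Longrightarrow> f t \<theta> \<le> g t \<theta>"
  shows "cint f t \<le> cint g t"
  unfolding cint_def by (intro integral_le jcont_integrable assms) auto

lemma cint_eqI:
  assumes "\<And>\<theta>. \<theta> \<in> {0..2*pi} \<Longrightarrow> f t \<theta> = g t \<theta>"
  shows "cint f t = cint g t"
  unfolding cint_def by (intro integral_cong assms) auto

lemma jcont_abs: "jcont f \<Longrightarrow> jcont (\<lambda>t \<theta>. \<bar>f t \<theta>\<bar>)"
  by (rule jcontI, rule continuous_on_rabs, rule jcont_compose) (auto intro: continuous_intros)

lemma abs_cint_le: "jcont f \<Longrightarrow> \<bar>cint f t\<bar> \<le> cint (\<lambda>t \<theta>. \<bar>f t \<theta>\<bar>) t"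
  using integral_norm_bound_integral[of "f t" "{0..2*pi}" "\<lambda>\<theta>. \<bar>f t \<theta>\<bar>"]
  by (simp add: cint_def jcont_integrable jcont_integrable[OF jcont_abs])

lemma cint_nonneg: "jcont f \<Longrightarrow> (\<And>\<theta>. f t \<theta> \<ge> 0) \<Longrightarrow> cint f t \<ge> 0"
  unfolding cint_def by (intro integral_nonneg jcont_integrable) auto

text \<open>This is integration by parts on the circle: the fundamental theorem leaves only a
  boundary difference, which periodicity kills.\<close>

lemma cint_derivative_eq_0:
  assumes "\<And>\<theta>. (f t has_real_derivative f' t \<theta>) (at \<theta>)" "f t (2*pi) = f t 0"
  shows "cint f' t = 0"
proof -
  have "(f' t has_integral (f t (2*pi) - f t 0)) {0..2*pi}"
    using assms(1)
    by (intro fundamental_theorem_of_calculus)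
       (auto simp: has_real_derivative_iff_has_vector_derivative[symmetric] intro: DERIV_subset)
  thus ?thesis using assms(2) by (auto simp: cint_def)
qed

text \<open>Both mixed partials arise by differentiating \<open>\<integral> f\<^sub>\<theta> d\<theta> = f t b - f t a\<close>
in \<open>t\<close> under the integral sign and then in \<open>b\<close>.\<close>

lemma mixed_partials_eq:
  fixes f :: "real \<Rightarrow> real \<Rightarrow> real"
  assumes ft: "\<And>t \<theta>. ((\<lambda>t. f t \<theta>) has_real_derivative ft t \<theta>) (at t)"
    and fh: "\<And>t \<theta>. (f t has_real_derivative fh t \<theta>) (at \<theta>)"
    and fth: "\<And>t \<theta>. (ft t has_real_derivative fth t \<theta>) (at \<theta>)"
    and fht: "\<And>t \<theta>. ((\<lambda>t. fh t \<theta>) has_real_derivative fht t \<theta>) (at t)"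
    and c: "jcont fh" "jcont fht"
  shows "fth t \<theta> = fht t \<theta>"
proof -
  \<comment> \<open>Starting at \<open>\<theta>-1\<close> makes \<open>\<theta>\<close> an interior
    point of the range of \<open>b\<close>, so that the derivative found at the end is
    two-sided.\<close>
  have FTC: "integral {\<theta>-1..b} (fh t) = f t b - f t (\<theta>-1)" if "b \<ge> \<theta>-1" for t b
    using that fh
    by (intro integral_unique fundamental_theorem_of_calculus)
       (auto simp: has_real_derivative_iff_has_vector_derivative[symmetric] intro: DERIV_subset)
  have *: "ft t b - ft t (\<theta>-1) = integral {\<theta>-1..b} (fht t)" if "b \<ge> \<theta>-1" for b
  proof -
    have "((\<lambda>x. integral (cbox (\<theta>-1) b) (fh x)) has_real_derivative integral (cbox (\<theta>-1) b) (fht t)) (at t within UNIV)"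
      using c fht
      by (intro leibniz_rule_field_derivative)
         (auto simp: jcont_integrable jcont_def intro: continuous_on_subset)
    moreover have "((\<lambda>x. integral (cbox (\<theta>-1) b) (fh x)) has_real_derivative ft t b - ft t (\<theta>-1)) (at t)"
      using FTC[OF that] by (auto intro!: derivative_eq_intros ft)
    ultimately show ?thesis using DERIV_unique by fastforce
  qed
  have "((\<lambda>b. integral {\<theta>-1..b} (fht t)) has_real_derivative fht t \<theta>) (at \<theta> within {\<theta>-1..\<theta>+1})"
    by (intro integral_has_real_derivative jcont_slice c) auto
  hence 1: "((\<lambda>b. ft t b - ft t (\<theta>-1)) has_real_derivative fht t \<theta>) (at \<theta> within {\<theta>-1..\<theta>+1})"
    by (rule has_field_derivative_transform_within[where d=1]) (auto simp: *)
  have "at \<theta> within {\<theta>-1..\<theta>+1} = at \<theta>"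
    by (rule at_within_interior) auto
  with 1 have "((\<lambda>b. ft t b - ft t (\<theta>-1)) has_real_derivative fht t \<theta>) (at \<theta>)" by simp
  moreover have "((\<lambda>b. ft t b - ft t (\<theta>-1)) has_real_derivative fth t \<theta>) (at \<theta>)"
    by (auto intro!: derivative_eq_intros fth)
  ultimately show ?thesis using DERIV_unique by blast
qed

section \<open>A convex function of linear growth\<close>

text \<open>Linear growth makes \<open>\<integral> kap V\<close> controllable by the one-sided bound on \<open>U\<close> alone, and
the bound on the first derivative makes the error term integrable. Moreover
\<open>sqrt (kap2 / 2)\<close> is the derivative of \<open>arctan\<close>, see \<open>small_oscillation\<close> below.\<close>

definition kap :: "real \<Rightarrow> real" where "kap s = s * arctan s"
definition kap1 :: "real \<Rightarrow> real" where "kap1 s = arctan s + s / (1 + s\<^sup>2)"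
definition kap2 :: "real \<Rightarrow> real" where "kap2 s = 2 / (1 + s\<^sup>2)\<^sup>2"

lemma one_plus_sq_ne_0 [simp]: "1 + s\<^sup>2 \<noteq> (0::real)" "1 + s * s \<noteq> (0::real)"
  using zero_le_square[of s] by (simp_all only: power2_eq_square)

lemma kap_derivative [derivative_intros]:
  assumes "(f has_real_derivative f') (at x within S)"
  shows "((\<lambda>x. kap (f x)) has_real_derivative kap1 (f x) * f') (at x within S)"
  unfolding kap_def kap1_def
  by (rule assms derivative_eq_intros refl | simp)+ (simp add: field_simps)

lemma kap1_derivative [derivative_intros]:
  assumes "(f has_real_derivative f') (at x within S)"
  shows "((\<lambda>x. kap1 (f x)) has_real_derivative kap2 (f x) * f') (at x within S)"
  unfolding kap2_def kap1_def
  apply (rule assms derivative_eq_intros refl | simp)+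
  apply (simp add: divide_simps)
  apply (simp add: algebra_simps power2_eq_square)
  done

lemma continuous_kap [continuous_intros]:
  assumes "continuous_on S f"
  shows "continuous_on S (\<lambda>x. kap (f x))" "continuous_on S (\<lambda>x. kap1 (f x))" "continuous_on S (\<lambda>x. kap2 (f x))"
  unfolding kap_def kap1_def kap2_def by (intro continuous_intros assms ballI; simp)+

text \<open>The \<open>arctan\<close> term contributes 2, because pi/2 < 2, and the quotient
  contributes 1.\<close>

lemma abs_kap1_le: "\<bar>kap1 s\<bar> \<le> 3"
proof -
  have "\<bar>arctan s\<bar> \<le> 2" using arctan_ubound[of s] arctan_lbound[of s] pi_half_less_two by linarith
  moreover have "\<bar>s / (1 + s\<^sup>2)\<bar> \<le> 1"
  proof -
    have "0 \<le> (\<bar>s\<bar> - 1)\<^sup>2" by simp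
    also have "\<dots> = s\<^sup>2 + 1 - 2 * \<bar>s\<bar>" by (simp add: power2_eq_square algebra_simps abs_if)
    finally have "\<bar>s\<bar> \<le> 1 + s\<^sup>2" using abs_ge_zero[of s] by linarith
    moreover have "0 < 1 + s\<^sup>2" by (simp add: add_pos_nonneg)
    ultimately show ?thesis by (simp add: abs_divide)
  qed
  ultimately show ?thesis unfolding kap1_def by linarith
qed

lemma kap_le: "kap s \<le> 2 * \<bar>s\<bar>"
proof -
  have "\<bar>arctan s\<bar> \<le> 2" using arctan_ubound[of s] arctan_lbound[of s] pi_half_less_two by linarith
  hence "\<bar>s\<bar> * \<bar>arctan s\<bar> \<le> \<bar>s\<bar> * 2" by (intro mult_left_mono) auto
  thus ?thesis unfolding kap_def abs_mult[symmetric] by linarith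
qed

lemma kap2_pos: "kap2 s > 0"
  unfolding kap2_def by (simp add: zero_less_power add_pos_nonneg)

text \<open>Integrate twice. The error \<open>h\<close> has running integrals at most
  \<open>M\<close>, so it lowers the slope by \<open>M\<close> at most and cannot affect the
  quadratic term.\<close>

lemma growth_from_second_derivative:
  fixes f f1 f2 h :: "real \<Rightarrow> real"
  assumes f: "\<And>t. t \<ge> a \<Longrightarrow> (f has_real_derivative f1 t) (at t)"
    and f1: "\<And>t. t \<ge> a \<Longrightarrow> (f1 has_real_derivative f2 t) (at t)"
    and f2: "\<And>t. t \<ge> a \<Longrightarrow> f2 t \<ge> \<delta> - h t"
    and h: "\<And>b. b \<ge> a \<Longrightarrow> h integrable_on {a..b}" "\<And>b. b \<ge> a \<Longrightarrow> integral {a..b} h \<le> M"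
    and T: "T \<ge> a"
  shows "f T \<ge> f a + (f1 a - M) * (T - a) + \<delta> * (T - a)\<^sup>2 / 2"
proof -
  have 1: "f1 t \<ge> f1 a - M + \<delta> * (t - a)" if "t \<ge> a" for t
  proof -
    have up: "(f2 has_integral (f1 t - f1 a)) {a..t}"
      using that f1 by (intro fundamental_theorem_of_calculus)
        (auto simp: has_real_derivative_iff_has_vector_derivative[symmetric] intro: DERIV_subset)
    have low: "((\<lambda>t. \<delta> - h t) has_integral (\<delta> * (t - a) - integral {a..t} h)) {a..t}"
      using has_integral_const_real[of \<delta> a t] that
      by (intro has_integral_diff integrable_integral h) (auto simp: mult.commute)
    have "\<delta> * (t - a) - integral {a..t} h \<le> f1 t - f1 a"
      by (rule has_integral_le[OF low up]) (use f2 in auto)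
    with h(2)[OF that] show ?thesis by linarith
  qed
  define F where "F = (\<lambda>t. f t - (f1 a - M) * (t - a) - \<delta> * (t - a)\<^sup>2 / 2)"
  have "F a \<le> F T"
  proof (rule DERIV_nonneg_imp_nondecreasing[OF T])
    fix x assume x: "a \<le> x" "x \<le> T"
    have "(F has_real_derivative (f1 x - (f1 a - M) - \<delta> * (x - a))) (at x)"
      unfolding F_def using f[OF x(1)] by (auto intro!: derivative_eq_intros)
    thus "\<exists>y. (F has_real_derivative y) (at x) \<and> 0 \<le> y"
      using 1[OF x(1)] by (auto intro!: exI)
  qed
  thus ?thesis by (simp add: F_def)
qed

section \<open>The equation on the cylinder\<close>

text \<open>\<open>Uht\<close> is both mixed second derivatives.\<close>

locale cylinder =
  fixes U Ut Uh Utt Uht Uhh P Pt :: "real \<Rightarrow> real \<Rightarrow> real" and C M :: real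
  assumes cont: "jcont U" "jcont Ut" "jcont Uh" "jcont Utt" "jcont Uht" "jcont Uhh" "jcont P" "jcont Pt"
    and dU_t: "\<And>t \<theta>. ((\<lambda>t. U t \<theta>) has_real_derivative Ut t \<theta>) (at t)"
    and dU_h: "\<And>t \<theta>. (U t has_real_derivative Uh t \<theta>) (at \<theta>)"
    and dUt_t: "\<And>t \<theta>. ((\<lambda>t. Ut t \<theta>) has_real_derivative Utt t \<theta>) (at t)"
    and dUt_h: "\<And>t \<theta>. (Ut t has_real_derivative Uht t \<theta>) (at \<theta>)"
    and dUh_t: "\<And>t \<theta>. ((\<lambda>t. Uh t \<theta>) has_real_derivative Uht t \<theta>) (at t)"
    and dUh_h: "\<And>t \<theta>. (Uh t has_real_derivative Uhh t \<theta>) (at \<theta>)"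
    and dP_t: "\<And>t \<theta>. ((\<lambda>t. P t \<theta>) has_real_derivative Pt t \<theta>) (at t)"
    and periodic: "\<And>t. U t (2*pi) = U t 0" "\<And>t. Ut t (2*pi) = Ut t 0" "\<And>t. Uh t (2*pi) = Uh t 0"
    and Pt_nonpos: "\<And>t \<theta>. Pt t \<theta> \<le> 0"
    and equation: "\<And>t \<theta>. Utt t \<theta> + Uhh t \<theta> = - (exp (2*t) * P t \<theta> * exp (2 * U t \<theta>))"
    and U_le: "\<And>t \<theta>. U t \<theta> \<le> C"
    and mass: "\<And>T. T \<ge> 0 \<Longrightarrow>
      integral {0..T} (cint (\<lambda>t \<theta>. \<bar>exp (2*t) * P t \<theta> * exp (2 * U t \<theta>)\<bar>)) \<le> M"
begin

lemmas jc [continuous_intros] =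
  jcont_compose[OF cont(1)] jcont_compose[OF cont(2)] jcont_compose[OF cont(3)] jcont_compose[OF cont(4)]
  jcont_compose[OF cont(5)] jcont_compose[OF cont(6)] jcont_compose[OF cont(7)] jcont_compose[OF cont(8)]

definition g :: "real \<Rightarrow> real \<Rightarrow> real"
  where "g t \<theta> = exp (2*t) * P t \<theta> * exp (2 * U t \<theta>)"

text \<open>The absolute curvature carried by one circle. By \<open>mass\<close> its integral over
  nonnegative times is at most \<open>M\<close>, so errors bounded by multiples of \<open>G\<close>
  are integrable.\<close>

definition G :: "real \<Rightarrow> real" where "G = cint (\<lambda>t \<theta>. \<bar>g t \<theta>\<bar>)"

definition m :: "real \<Rightarrow> real" where "m t = cint U t / (2*pi)"
definition m1 :: "real \<Rightarrow> real" where "m1 t = cint Ut t / (2*pi)"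
definition m2 :: "real \<Rightarrow> real" where "m2 t = cint Utt t / (2*pi)"
definition V :: "real \<Rightarrow> real \<Rightarrow> real" where "V t \<theta> = U t \<theta> - m t"

lemma jg: "jcont g"
  unfolding g_def[abs_def] by (rule jcontI) (intro continuous_intros)

lemmas jcg [continuous_intros] = jcont_compose[OF jg]

lemma jG: "jcont (\<lambda>t \<theta>. \<bar>g t \<theta>\<bar>)" by (rule jcont_abs[OF jg])

lemma cont_G: "continuous_on S G" unfolding G_def by (rule cint_continuous[OF jG])

lemma G_nonneg: "G t \<ge> 0" unfolding G_def by (rule cint_nonneg[OF jG]) auto

lemma m_derivatives:
  "(m has_real_derivative m1 t) (at t)" "(m1 has_real_derivative m2 t) (at t)"
proof -
  show "(m has_real_derivative m1 t) (at t)"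
    unfolding m_def[abs_def] m1_def
    by (intro DERIV_cdivide cint_has_derivative dU_t cont)
  show "(m1 has_real_derivative m2 t) (at t)"
    unfolding m2_def m1_def[abs_def]
    by (intro DERIV_cdivide cint_has_derivative dUt_t cont)
qed

lemma Utt_eq: "Utt t \<theta> = - g t \<theta> - Uhh t \<theta>"
  using equation[of t \<theta>] by (simp add: g_def)

lemma cint_Uhh: "cint Uhh t = 0"
  by (rule cint_derivative_eq_0[OF dUh_h periodic(3)])

lemma cint_Utt: "cint Utt t = - cint g t"
proof -
  have "cint Utt t = cint (\<lambda>t \<theta>. (-1) * g t \<theta> - Uhh t \<theta>) t"
    by (rule cint_eqI) (simp add: Utt_eq)
  also have "\<dots> = cint (\<lambda>t \<theta>. (-1) * g t \<theta>) t - cint Uhh t"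
    by (intro cint_diff cont jcontI continuous_intros)
  finally show ?thesis by (simp add: cint_Uhh cint_cmult[of "\<lambda>_. -1", simplified])
qed

lemma abs_cint_g: "\<bar>cint g t\<bar> \<le> G t"
  unfolding G_def by (rule abs_cint_le[OF jg])

lemma abs_m2: "2 * pi * \<bar>m2 t\<bar> \<le> G t"
  using abs_cint_g[of t] by (simp add: m2_def cint_Utt abs_divide)

lemma G_integrable: "G integrable_on {a..b}"
  by (intro integrable_continuous_real cont_G)

lemma integral_G_le:
  assumes "0 \<le> a" shows "integral {a..b} G \<le> M"
proof (cases "a \<le> b")
  case True
  have "integral {a..b} G \<le> integral {0..b} G"
    using assms G_nonneg by (intro integral_subset_le G_integrable) auto
  also have "\<dots> \<le> M" using mass[of b] True assms by (simp add: G_def g_def)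
  finally show ?thesis .
next
  case False
  thus ?thesis using mass[of 0] by simp
qed

lemma cont_m [continuous_intros]:
  assumes "continuous_on S f"
  shows "continuous_on S (\<lambda>x. m (f x))" "continuous_on S (\<lambda>x. m1 (f x))" "continuous_on S (\<lambda>x. m2 (f x))"
proof -
  have *: "continuous_on UNIV m" "continuous_on UNIV m1" "continuous_on UNIV m2"
    unfolding m_def[abs_def] m1_def[abs_def] m2_def[abs_def]
    by (intro continuous_on_divide cint_continuous cont continuous_on_const; simp)+
  show "continuous_on S (\<lambda>x. m (f x))" "continuous_on S (\<lambda>x. m1 (f x))" "continuous_on S (\<lambda>x. m2 (f x))"
    by (rule continuous_on_compose2[OF *(1) assms] continuous_on_compose2[OF *(2) assms]
         continuous_on_compose2[OF *(3) assms]; simp)+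
qed

lemma cV [continuous_intros]:
  "continuous_on S a \<Longrightarrow> continuous_on S b \<Longrightarrow> continuous_on S (\<lambda>x. V (a x) (b x))"
  unfolding V_def by (intro continuous_intros)

lemma V_derivatives:
  "((\<lambda>t. V t \<theta>) has_real_derivative Ut t \<theta> - m1 t) (at t)"
  "((\<lambda>\<theta>. V t \<theta>) has_real_derivative Uh t \<theta>) (at \<theta>)"
  unfolding V_def using dU_t dU_h m_derivatives by (auto intro!: derivative_eq_intros)

lemma cint_V: "cint V t = 0"
proof -
  have "cint V t = cint U t - cint (\<lambda>t \<theta>. m t) t"
    unfolding V_def[abs_def] by (intro cint_diff cont jcontI continuous_intros)
  thus ?thesis by (simp add: cint_const m_def)
qed

lemma V_periodic: "V t (2*pi) = V t 0"
  by (simp add: V_def periodic)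

lemma m_le_C: "m t \<le> C"
proof -
  have "cint U t \<le> cint (\<lambda>t \<theta>. C) t"
    by (intro cint_mono cont jcontI continuous_intros U_le)
  thus ?thesis by (simp add: m_def cint_const divide_simps mult.commute)
qed

lemma m2_has_integral:
  assumes "a \<le> b"
  shows "(m2 has_integral (m1 b - m1 a)) {a..b}"
  using assms m_derivatives(2)
  by (intro fundamental_theorem_of_calculus)
     (auto simp: has_real_derivative_iff_has_vector_derivative[symmetric] intro: DERIV_subset)

lemma m1_diff:
  assumes "a \<le> b"
  shows "\<bar>m1 b - m1 a\<bar> \<le> integral {a..b} G"
proof -
  have "m1 b - m1 a = integral {a..b} m2" "m2 integrable_on {a..b}"
    using m2_has_integral[OF assms] by (auto simp: integral_unique)
  \<comment> \<open>The factor \<open>2*pi\<close> of \<open>abs_m2\<close> is given away, since the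
    result only serves the crude bound \<open>m_lower\<close>.\<close>
  moreover have "\<bar>m2 t\<bar> \<le> G t" for t
  proof -
    have "1 * \<bar>m2 t\<bar> \<le> 2 * pi * \<bar>m2 t\<bar>" using pi_gt3 by (intro mult_right_mono) auto
    with abs_m2[of t] show ?thesis by linarith
  qed
  ultimately show ?thesis
    using integral_norm_bound_integral[of m2 "{a..b}" G] G_integrable by auto
qed

text \<open>The slope \<open>m1\<close> never moves further than the total mass \<open>M\<close>
  from \<open>m1 0\<close>. Through \<open>Phi_le\<close> this caps the growth of \<open>Phi\<close>
  by a linear function.\<close>

lemma m_lower: "\<exists>K\<ge>0. \<forall>t\<ge>0. m t \<ge> m 0 - K * t"
proof (intro exI conjI allI impI)
  have M: "M \<ge> 0" using mass[of 0] by simp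
  let ?K = "\<bar>m1 0\<bar> + M"
  show "0 \<le> ?K" using M by simp
  fix t :: real assume t: "t \<ge> 0"
  have "(\<lambda>t. m t + ?K * t) 0 \<le> (\<lambda>t. m t + ?K * t) t"
  proof (rule DERIV_nonneg_imp_nondecreasing[OF t])
    fix x :: real assume x: "0 \<le> x" "x \<le> t"
    have "((\<lambda>t. m t + ?K * t) has_real_derivative m1 x + ?K) (at x)"
      by (auto intro!: derivative_eq_intros m_derivatives)
    moreover have "\<bar>m1 x - m1 0\<bar> \<le> M"
      using m1_diff[OF x(1)] integral_G_le[of 0 x] by simp
    hence "0 \<le> m1 x + ?K" by linarith
    ultimately show "\<exists>y. ((\<lambda>t. m t + ?K * t) has_real_derivative y) (at x) \<and> 0 \<le> y" by blast
  qed
  thus "m 0 - ?K * t \<le> m t" by simp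
qed

section \<open>The convex functional and the almost radial times\<close>

definition Phi :: "real \<Rightarrow> real" where "Phi = cint (\<lambda>t \<theta>. kap (V t \<theta>))"
definition Phi1 :: "real \<Rightarrow> real" where "Phi1 = cint (\<lambda>t \<theta>. kap1 (V t \<theta>) * (Ut t \<theta> - m1 t))"
definition Phi2 :: "real \<Rightarrow> real" where
  "Phi2 = cint (\<lambda>t \<theta>. kap2 (V t \<theta>) * (Ut t \<theta> - m1 t)\<^sup>2 + kap1 (V t \<theta>) * (Utt t \<theta> - m2 t))"
text \<open>This is twice the Dirichlet energy of \<open>arctan V\<close> along the circle.\<close>

definition D :: "real \<Rightarrow> real" where "D = cint (\<lambda>t \<theta>. kap2 (V t \<theta>) * (Uh t \<theta>)\<^sup>2)"

lemma Phi_derivatives: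
  "(Phi has_real_derivative Phi1 t) (at t)" "(Phi1 has_real_derivative Phi2 t) (at t)"
proof -
  show "(Phi has_real_derivative Phi1 t) (at t)"
    unfolding Phi_def Phi1_def
    by (intro cint_has_derivative kap_derivative V_derivatives jcontI continuous_intros)
  show "(Phi1 has_real_derivative Phi2 t) (at t)"
    unfolding Phi2_def Phi1_def
    by (intro cint_has_derivative jcontI continuous_intros)
       (auto intro!: derivative_eq_intros V_derivatives m_derivatives dUt_t simp: power2_eq_square)
qed

text \<open>Adding the integral of the \<open>\<theta>\<close>-derivative of
  \<open>kap1 V * Uh\<close>, which is zero, produces \<open>D\<close> and completes
  \<open>Utt\<close> to \<open>Utt + Uhh = - g\<close>. The square in \<open>Ut - m1\<close> is
  dropped by convexity, and what remains is \<open>kap1 V\<close> times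
  \<open>- (g + m2)\<close>.\<close>

lemma Phi2_ge: "Phi2 t \<ge> D t - 6 * G t"
proof -
  have "cint (\<lambda>t \<theta>. kap2 (V t \<theta>) * (Uh t \<theta>)\<^sup>2 + kap1 (V t \<theta>) * Uhh t \<theta>) t = 0"
    by (rule cint_derivative_eq_0[where f = "\<lambda>t \<theta>. kap1 (V t \<theta>) * Uh t \<theta>"])
       (auto intro!: derivative_eq_intros V_derivatives dUh_h simp: periodic V_periodic power2_eq_square)
  moreover have "D t - 6 * G t \<le> Phi2 t + cint (\<lambda>t \<theta>. kap2 (V t \<theta>) * (Uh t \<theta>)\<^sup>2 + kap1 (V t \<theta>) * Uhh t \<theta>) t"
  proof -
    \<comment> \<open>The bound 3 on \<open>kap1\<close> costs \<open>3 * G\<close> for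
      \<open>g\<close> and \<open>2 * pi * 3 * \<bar>m2\<bar>\<close>, again at most
      \<open>3 * G\<close>, for the mean; together they make up \<open>6 * G\<close>.\<close>
    have "D t - 3 * G t - 2 * pi * (3 * \<bar>m2 t\<bar>)
        = cint (\<lambda>t \<theta>. kap2 (V t \<theta>) * (Uh t \<theta>)\<^sup>2 - 3 * \<bar>g t \<theta>\<bar> - 3 * \<bar>m2 t\<bar>) t"
      by (subst cint_diff, (intro jcontI continuous_intros)+, subst cint_diff, (intro jcontI continuous_intros)+)
         (simp add: D_def G_def cint_const cint_cmult[of "\<lambda>_. 3"])
    also have "\<dots> \<le> cint (\<lambda>t \<theta>. (kap2 (V t \<theta>) * (Ut t \<theta> - m1 t)\<^sup>2 + kap1 (V t \<theta>) * (Utt t \<theta> - m2 t))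
         + (kap2 (V t \<theta>) * (Uh t \<theta>)\<^sup>2 + kap1 (V t \<theta>) * Uhh t \<theta>)) t"
    proof (rule cint_mono; (intro jcontI continuous_intros)?)
      fix \<theta>
      have 1: "0 \<le> kap2 (V t \<theta>) * (Ut t \<theta> - m1 t)\<^sup>2"
        using kap2_pos[of "V t \<theta>"] by simp
      have "\<bar>kap1 (V t \<theta>) * (g t \<theta> + m2 t)\<bar> \<le> 3 * (\<bar>g t \<theta>\<bar> + \<bar>m2 t\<bar>)"
        unfolding abs_mult by (intro mult_mono abs_kap1_le abs_triangle_ineq) auto
      hence "kap1 (V t \<theta>) * (g t \<theta> + m2 t) \<le> 3 * \<bar>g t \<theta>\<bar> + 3 * \<bar>m2 t\<bar>"
        by (simp add: abs_le_iff)
      moreover have "kap1 (V t \<theta>) * (Utt t \<theta> - m2 t) + kap1 (V t \<theta>) * Uhh t \<theta> = - (kap1 (V t \<theta>) * (g t \<theta> + m2 t))"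
        by (simp add: Utt_eq algebra_simps)
      ultimately show "kap2 (V t \<theta>) * (Uh t \<theta>)\<^sup>2 - 3 * \<bar>g t \<theta>\<bar> - 3 * \<bar>m2 t\<bar>
        \<le> kap2 (V t \<theta>) * (Ut t \<theta> - m1 t)\<^sup>2 + kap1 (V t \<theta>) * (Utt t \<theta> - m2 t)
         + (kap2 (V t \<theta>) * (Uh t \<theta>)\<^sup>2 + kap1 (V t \<theta>) * Uhh t \<theta>)"
        using 1 by linarith
    qed
    also have "\<dots> = Phi2 t + cint (\<lambda>t \<theta>. kap2 (V t \<theta>) * (Uh t \<theta>)\<^sup>2 + kap1 (V t \<theta>) * Uhh t \<theta>) t"
      unfolding Phi2_def by (intro cint_add jcontI continuous_intros)
    finally show ?thesis using abs_m2[of t] by linarith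
  qed
  ultimately show ?thesis by linarith
qed

text \<open>A one-sided bound on \<open>V\<close> suffices: \<open>2 * \<bar>V\<bar>\<close> equals
  four times the positive part of \<open>V\<close> minus \<open>2 * V\<close>, the positive part is
  at most \<open>C - m\<close>, and \<open>V\<close> has mean zero.\<close>

lemma Phi_le: "Phi t \<le> 8 * pi * (C - m t)"
proof -
  have "Phi t \<le> cint (\<lambda>t \<theta>. 4 * (C - m t) - 2 * V t \<theta>) t"
    unfolding Phi_def
  proof (rule cint_mono; (intro jcontI continuous_intros)?)
    fix \<theta>
    have "V t \<theta> \<le> C - m t" using U_le[of t \<theta>] by (simp add: V_def)
    thus "kap (V t \<theta>) \<le> 4 * (C - m t) - 2 * V t \<theta>"
      using kap_le[of "V t \<theta>"] m_le_C[of t] by (cases "V t \<theta> \<ge> 0") auto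
  qed
  also have "\<dots> = 8 * pi * (C - m t)"
    by (subst cint_diff, (intro jcontI continuous_intros)+)
       (simp add: cint_V cint_const cint_cmult[of "\<lambda>_. 2"])
  finally show ?thesis .
qed

text \<open>Otherwise \<open>Phi\<close> would grow quadratically from \<open>T0\<close> on, while
  \<open>Phi_le\<close> and \<open>m_lower\<close> allow only linear growth.\<close>

lemma good_times:
  assumes "\<delta> > 0" "T0 \<ge> 0"
  shows "\<exists>t\<ge>T0. D t + G t < \<delta>"
proof (rule ccontr)
  assume "\<not> ?thesis"
  hence bad: "D t + G t \<ge> \<delta>" if "t \<ge> T0" for t using that by force
  obtain K where K: "K \<ge> 0" "\<And>t. t \<ge> 0 \<Longrightarrow> m t \<ge> m 0 - K * t" using m_lower by blast
  \<comment> \<open>The 7 is the 6 of \<open>Phi2_ge\<close> plus one more \<open>G\<close> from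
    \<open>D \<ge> \<delta> - G\<close>.\<close>
  have lower: "Phi T \<ge> Phi T0 + (Phi1 T0 - 7 * M) * (T - T0) + \<delta> * (T - T0)\<^sup>2 / 2" if "T \<ge> T0" for T
  proof (rule growth_from_second_derivative[where h = "\<lambda>t. 7 * G t" and ?f1.0 = Phi1 and ?f2.0 = Phi2])
    show "\<delta> - 7 * G t \<le> Phi2 t" if "t \<ge> T0" for t
      using bad[OF that] Phi2_ge[of t] by linarith
  qed (use assms that Phi_derivatives integral_G_le G_integrable in \<open>auto intro: integrable_on_mult_right\<close>)
  define a where "a = 8 * pi * (C - m 0 + K * T0) - Phi T0"
  define b where "b = 8 * pi * K - (Phi1 T0 - 7 * M)"
  have upper: "\<delta> * s\<^sup>2 / 2 \<le> a + b * s" if "s \<ge> 0" for s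
  proof -
    have "Phi (T0 + s) \<le> 8 * pi * (C - m (T0 + s))" by (rule Phi_le)
    also have "\<dots> \<le> 8 * pi * (C - (m 0 - K * (T0 + s)))"
      using K(2)[of "T0 + s"] that assms by (intro mult_left_mono) auto
    finally show ?thesis using lower[of "T0 + s"] that
      by (simp add: a_def b_def algebra_simps)
  qed
  \<comment> \<open>The first summand gives \<open>\<delta> * s / 2 \<ge> \<bar>b\<bar> + 1\<close>
    and the others give \<open>s > \<bar>a\<bar>\<close>, whence
    \<open>\<delta> * s\<^sup>2 / 2 \<ge> b * s + s > b * s + a\<close>.\<close>
  define s where "s = 2 * (\<bar>b\<bar> + 1) / \<delta> + \<bar>a\<bar> + 1"
  have s: "s \<ge> 2 * (\<bar>b\<bar> + 1) / \<delta>" "s > \<bar>a\<bar>" "s > 0"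
  proof -
    have "2 * (\<bar>b\<bar> + 1) / \<delta> > 0" using assms by (intro divide_pos_pos) auto
    thus "s \<ge> 2 * (\<bar>b\<bar> + 1) / \<delta>" "s > \<bar>a\<bar>" "s > 0" by (simp_all only: s_def)
  qed
  have "\<delta> * s / 2 \<ge> \<bar>b\<bar> + 1" using s(1) assms by (simp add: field_simps)
  hence "(\<delta> * s / 2) * s \<ge> (\<bar>b\<bar> + 1) * s" using s by (intro mult_right_mono) auto
  moreover have "(\<bar>b\<bar> + 1) * s \<ge> b * s + s"
    using s mult_right_mono[of b "\<bar>b\<bar>" s] by (simp add: algebra_simps)
  moreover have "\<delta> * s\<^sup>2 / 2 = (\<delta> * s / 2) * s" by (simp add: power2_eq_square)
  ultimately show False using upper[of s] s by linarith
qed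

text \<open>\<open>V\<close> has mean zero, hence a zero, and \<open>arctan V\<close> oscillates by at most
\<open>\<integral> \<bar>U\<^sub>\<theta>\<bar> / (1 + V\<^sup>2) d\<theta> < pi / 4 = arctan 1\<close>.\<close>

lemma small_oscillation:
  assumes "D t < 1/100"
  shows "\<theta> \<in> {0..2*pi} \<Longrightarrow> \<bar>V t \<theta>\<bar> \<le> 1" "cint (\<lambda>t \<theta>. (Uh t \<theta>)\<^sup>2) t \<le> 2 * D t"
proof -
  have cVt: "continuous_on S (V t)" for S
    using cV[of S "\<lambda>_. t" "\<lambda>x. x"] by (auto intro: continuous_intros)
  \<comment> \<open>The primitive of \<open>V\<close> vanishes at both ends because \<open>V\<close>
    has mean zero; Rolle's theorem then yields a zero of \<open>V\<close>.\<close>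
  obtain z where z: "0 < z" "z < 2*pi" "V t z = 0"
  proof -
    let ?A = "\<lambda>x. integral {0..x} (V t)"
    have d: "(?A has_real_derivative V t x) (at x)" if "0 < x" "x < 2*pi" for x
    proof -
      have "(?A has_real_derivative V t x) (at x within {0..2*pi})"
        using that by (intro integral_has_real_derivative cVt) auto
      moreover have "at x within {0..2*pi} = at x"
        using that by (intro at_within_interior) auto
      ultimately show ?thesis by simp
    qed
    have "\<exists>z. 0 < z \<and> z < 2*pi \<and> (?A has_real_derivative 0) (at z)"
    proof (rule Rolle)
      show "continuous_on {0..2*pi} ?A"
        by (intro indefinite_integral_continuous_1 integrable_continuous_real cVt)
      show "?A differentiable (at x)" if "0 < x" "x < 2*pi" for x
        using d[OF that] by (auto simp: real_differentiable_def)
    qed (use cint_V[of t] in \<open>auto simp: cint_def\<close>)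
    then obtain z where "0 < z" "z < 2*pi" "(?A has_real_derivative 0) (at z)" by blast
    with d[of z] that show thesis using DERIV_unique by blast
  qed
  define k where "k \<theta> = Uh t \<theta> / (1 + (V t \<theta>)\<^sup>2)" for \<theta>
  have ck: "continuous_on S k" for S
    unfolding k_def[abs_def] by (intro continuous_intros ballI) auto
  have k_sq: "kap2 (V t \<theta>) * (Uh t \<theta>)\<^sup>2 = 2 * (k \<theta>)\<^sup>2" for \<theta>
    by (simp add: kap2_def k_def power_divide)
  have D_eq: "D t = 2 * integral {0..2*pi} (\<lambda>\<theta>. (k \<theta>)\<^sup>2)"
    by (simp add: D_def cint_def k_sq)
  have int_k: "integral {0..2*pi} (\<lambda>\<theta>. \<bar>k \<theta>\<bar>) < pi / 4"
  proof -
    \<comment> \<open>The weights come from expanding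
      \<open>5 * (\<bar>k\<bar> - 1/10)\<^sup>2 \<ge> 0\<close>. As \<open>D < 1/100\<close>, the
      right side is below pi/10 + 1/40, which is less than pi/4.\<close>
    have "integral {0..2*pi} (\<lambda>\<theta>. \<bar>k \<theta>\<bar>) \<le> integral {0..2*pi} (\<lambda>\<theta>. 1/20 + 5 * (k \<theta>)\<^sup>2)"
    proof (rule integral_le; (intro integrable_continuous_real continuous_intros ck)?)
      fix \<theta>
      have "0 \<le> 5 * (\<bar>k \<theta>\<bar> - 1/10)\<^sup>2" by simp
      also have "\<dots> = 5 * (k \<theta>)\<^sup>2 - \<bar>k \<theta>\<bar> + 1/20"
        by (simp add: power2_diff field_simps)
      finally show "\<bar>k \<theta>\<bar> \<le> 1/20 + 5 * (k \<theta>)\<^sup>2" by linarith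
    qed
    also have "\<dots> = pi / 10 + 5 * integral {0..2*pi} (\<lambda>\<theta>. (k \<theta>)\<^sup>2)"
      by (subst Henstock_Kurzweil_Integration.integral_add)
         (auto intro!: integrable_continuous_real continuous_intros ck)
    also have "\<dots> < pi / 4" using assms pi_gt3 by (simp add: D_eq)
    finally show ?thesis .
  qed
  have arc: "\<bar>arctan (V t b) - arctan (V t a)\<bar> < pi / 4" if "0 \<le> a" "a \<le> b" "b \<le> 2*pi" for a b
  proof -
    have "((\<lambda>\<theta>. arctan (V t \<theta>)) has_real_derivative k \<theta>) (at \<theta>)" for \<theta>
      by (auto intro!: derivative_eq_intros V_derivatives simp: k_def field_simps)
    hence "(k has_integral (arctan (V t b) - arctan (V t a))) {a..b}"
      using that by (intro fundamental_theorem_of_calculus)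
        (auto simp: has_real_derivative_iff_has_vector_derivative[symmetric] intro: DERIV_subset)
    hence "arctan (V t b) - arctan (V t a) = integral {a..b} k" by (simp add: integral_unique)
    also have "\<bar>\<dots>\<bar> \<le> integral {a..b} (\<lambda>\<theta>. \<bar>k \<theta>\<bar>)"
      using integral_norm_bound_integral[of k "{a..b}" "\<lambda>\<theta>. \<bar>k \<theta>\<bar>"]
      by (auto intro!: integrable_continuous_real continuous_intros ck)
    also have "\<dots> \<le> integral {0..2*pi} (\<lambda>\<theta>. \<bar>k \<theta>\<bar>)"
      using that by (intro integral_subset_le integrable_continuous_real continuous_intros ck) auto
    also note int_k
    finally show ?thesis .
  qed
  show V1: "\<bar>V t \<theta>\<bar> \<le> 1" if "\<theta> \<in> {0..2*pi}" for \<theta>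
  proof -
    have "\<bar>arctan (V t \<theta>)\<bar> < pi / 4"
      using arc[of z \<theta>] arc[of \<theta> z] z that by (cases "z \<le> \<theta>") auto
    hence "arctan (V t \<theta>) < arctan 1" "arctan (-1) < arctan (V t \<theta>)"
      by (auto simp: arctan_one arctan_minus)
    thus ?thesis unfolding arctan_less_iff by linarith
  qed
  have "cint (\<lambda>t \<theta>. (Uh t \<theta>)\<^sup>2) t \<le> cint (\<lambda>t \<theta>. 2 * (kap2 (V t \<theta>) * (Uh t \<theta>)\<^sup>2)) t"
  proof (rule cint_mono; (intro jcontI continuous_intros)?)
    \<comment> \<open>On \<open>\<bar>V\<bar> \<le> 1\<close> the weight \<open>kap2 V\<close> is at
      least 1/2, so \<open>D\<close> controls the unweighted energy.\<close>
    fix \<theta> assume "\<theta> \<in> {0..2*pi}"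
    hence "\<bar>V t \<theta>\<bar>\<^sup>2 \<le> 1\<^sup>2" by (intro power_mono V1) auto
    hence "(1 + (V t \<theta>)\<^sup>2)\<^sup>2 \<le> 2\<^sup>2" by (intro power_mono) auto
    hence "1 \<le> 2 * kap2 (V t \<theta>)" by (simp add: kap2_def divide_simps)
    hence "1 * (Uh t \<theta>)\<^sup>2 \<le> 2 * kap2 (V t \<theta>) * (Uh t \<theta>)\<^sup>2" by (intro mult_right_mono) auto
    thus "(Uh t \<theta>)\<^sup>2 \<le> 2 * (kap2 (V t \<theta>) * (Uh t \<theta>)\<^sup>2)" by simp
  qed
  also have "\<dots> = 2 * D t" by (simp add: D_def cint_cmult[of "\<lambda>_. 2"])
  finally show "cint (\<lambda>t \<theta>. (Uh t \<theta>)\<^sup>2) t \<le> 2 * D t" .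
qed

section \<open>The Pohozaev identity\<close>

definition pohozaev :: "real \<Rightarrow> real"
  where "pohozaev = cint (\<lambda>t \<theta>. (Ut t \<theta>)\<^sup>2 - (Uh t \<theta>)\<^sup>2 + g t \<theta> + 2 * Ut t \<theta>)"

definition pohozaev_deriv :: "real \<Rightarrow> real"
  where "pohozaev_deriv = cint (\<lambda>t \<theta>. exp (2*t) * Pt t \<theta> * exp (2 * U t \<theta>))"

text \<open>The summand \<open>2 * Ut\<close> is there because \<open>2 * Utt\<close> cancels the
  \<open>2 * g\<close> that arises from differentiating \<open>exp (2*t)\<close> in
  \<open>g\<close>. By the equation the products \<open>g * Ut\<close> cancel as well. Apart from
  the term with \<open>Pt\<close>, only multiples of \<open>Uhh\<close> and of the
  \<open>\<theta>\<close>-derivative of \<open>Uh * Ut\<close> are left, and these integrate to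
  zero.\<close>

lemma pohozaev_derivative: "(pohozaev has_real_derivative pohozaev_deriv t) (at t)"
proof -
  let ?r = "\<lambda>t \<theta>. exp (2*t) * Pt t \<theta> * exp (2 * U t \<theta>)"
  let ?d = "\<lambda>t \<theta>. 2 * Ut t \<theta> * Utt t \<theta> - 2 * Uh t \<theta> * Uht t \<theta>
      + (2 * g t \<theta> + ?r t \<theta> + 2 * g t \<theta> * Ut t \<theta>) + 2 * Utt t \<theta>"
  have "(pohozaev has_real_derivative cint ?d t) (at t)"
    unfolding pohozaev_def
  proof (rule cint_has_derivative; (intro jcontI continuous_intros)?)
    fix t \<theta>
    show "((\<lambda>t. (Ut t \<theta>)\<^sup>2 - (Uh t \<theta>)\<^sup>2 + g t \<theta> + 2 * Ut t \<theta>) has_real_derivative ?d t \<theta>) (at t)"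
      unfolding g_def
      by (auto intro!: derivative_eq_intros dU_t dUt_t dUh_t dP_t simp: algebra_simps)
  qed
  moreover have "cint ?d t = cint ?r t"
  proof -
    have "cint ?d t = cint (\<lambda>t \<theta>. ?r t \<theta> - 2 * ((Uhh t \<theta> * Ut t \<theta> + Uh t \<theta> * Uht t \<theta>) + Uhh t \<theta>)) t"
      by (rule cint_eqI) (simp add: Utt_eq algebra_simps)
    also have "\<dots> = cint ?r t - 2 * (cint (\<lambda>t \<theta>. Uhh t \<theta> * Ut t \<theta> + Uh t \<theta> * Uht t \<theta>) t + cint Uhh t)"
      by (subst cint_diff, (intro jcontI continuous_intros)+, subst cint_cmult[of "\<lambda>_. 2"],
          subst cint_add) (intro jcontI continuous_intros refl)+
    also have "cint (\<lambda>t \<theta>. Uhh t \<theta> * Ut t \<theta> + Uh t \<theta> * Uht t \<theta>) t = 0"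
      by (rule cint_derivative_eq_0[where f = "\<lambda>t \<theta>. Uh t \<theta> * Ut t \<theta>"])
         (auto intro!: derivative_eq_intros dUh_h dUt_h simp: periodic)
    finally show ?thesis by (simp add: cint_Uhh)
  qed
  ultimately show ?thesis by (simp add: pohozaev_deriv_def)
qed

lemma pohozaev_deriv_integrand_nonpos: "exp (2*t) * Pt t \<theta> * exp (2 * U t \<theta>) \<le> 0"
  by (intro mult_nonpos_nonneg[of "exp (2*t) * Pt t \<theta>"] mult_nonneg_nonpos Pt_nonpos) auto

lemma pohozaev_deriv_nonpos: "pohozaev_deriv t \<le> 0"
proof -
  have "pohozaev_deriv t \<le> cint (\<lambda>t \<theta>. 0) t"
    unfolding pohozaev_deriv_def
    by (rule cint_mono; (intro jcontI continuous_intros pohozaev_deriv_integrand_nonpos)?)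
  thus ?thesis by (simp add: cint_const)
qed

lemma pohozaev_antimono: "a \<le> b \<Longrightarrow> pohozaev b \<le> pohozaev a"
  using pohozaev_derivative pohozaev_deriv_nonpos by (intro DERIV_nonpos_imp_nonincreasing[of a b pohozaev]) auto

text \<open>The decay hypotheses bound \<open>pohozaev\<close> above by \<open>K * exp t\<close> for
  \<open>t \<le> 0\<close>. Being antitone, it would vanish identically if it were never negative;
  its derivative would then be zero and, the integrand having one sign, \<open>Pt\<close> would
  vanish against \<open>nontrivial\<close>.\<close>

lemma pohozaev_eventually_negative:
  assumes decay: "\<And>t \<theta>. t \<le> 0 \<Longrightarrow> \<bar>Ut t \<theta>\<bar> \<le> B * exp t"
    "\<And>t \<theta>. t \<le> 0 \<Longrightarrow> \<bar>P t \<theta>\<bar> \<le> B"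
    and nontrivial: "Pt t0 \<theta>0 \<noteq> 0" "\<theta>0 \<in> {0..2*pi}"
  shows "\<exists>T. pohozaev T < 0"
proof (rule ccontr)
  assume "\<not> ?thesis"
  hence nonneg: "pohozaev t \<ge> 0" for t by (auto simp: not_less)
  have B: "B \<ge> 0" using decay(2)[of 0 0] by simp
  define K where "K = 2 * pi * (B\<^sup>2 + B * exp (2 * C) + 2 * B)"
  have upper: "pohozaev t \<le> K * exp t" if t: "t \<le> 0" for t
  proof -
    have e: "exp (2*t) \<le> exp t" using t by simp
    have "pohozaev t \<le> cint (\<lambda>t \<theta>. (B\<^sup>2 + B * exp (2 * C) + 2 * B) * exp t) t"
      unfolding pohozaev_def
    proof (rule cint_mono; (intro jcontI continuous_intros)?)
      fix \<theta>
      have "\<bar>Ut t \<theta>\<bar>\<^sup>2 \<le> (B * exp t)\<^sup>2" by (intro power_mono decay t) auto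
      also have "\<dots> = B\<^sup>2 * exp (2*t)" by (simp add: power_mult_distrib exp_double)
      also have "\<dots> \<le> B\<^sup>2 * exp t" using e by (intro mult_left_mono) auto
      finally have 1: "(Ut t \<theta>)\<^sup>2 \<le> B\<^sup>2 * exp t" by simp
      have "g t \<theta> \<le> \<bar>g t \<theta>\<bar>" by simp
      also have "\<dots> = exp (2*t) * \<bar>P t \<theta>\<bar> * exp (2 * U t \<theta>)" by (simp add: g_def abs_mult)
      also have "\<dots> \<le> exp t * B * exp (2 * C)"
        using e B by (intro mult_mono decay t) (auto intro: U_le)
      finally have 2: "g t \<theta> \<le> B * exp (2 * C) * exp t" by (simp add: mult_ac)
      show "(Ut t \<theta>)\<^sup>2 - (Uh t \<theta>)\<^sup>2 + g t \<theta> + 2 * Ut t \<theta> \<le> (B\<^sup>2 + B * exp (2 * C) + 2 * B) * exp t"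
      proof -
        have "2 * Ut t \<theta> \<le> 2 * B * exp t" using decay(1)[OF t, of \<theta>] by (simp add: abs_le_iff)
        moreover have "(B\<^sup>2 + B * exp (2 * C) + 2 * B) * exp t = B\<^sup>2 * exp t + B * exp (2 * C) * exp t + 2 * B * exp t"
          by (simp add: distrib_right)
        ultimately show ?thesis using 1 2 zero_le_power2[of "Uh t \<theta>"] by linarith
      qed
    qed
    also have "\<dots> = K * exp t" by (simp add: K_def cint_const)
    finally show ?thesis .
  qed
  have "pohozaev t = 0" for t
  proof (rule ccontr)
    assume "pohozaev t \<noteq> 0"
    hence pos: "pohozaev t > 0" using nonneg[of t] by simp
    \<comment> \<open>For every \<open>s\<close> below both \<open>t\<close> and 0, monotonicity
      gives \<open>pohozaev t \<le> pohozaev s \<le> K * exp s\<close>, which is absurd for very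
      negative \<open>s\<close>.\<close>
    have "((\<lambda>s. K * exp s) \<longlongrightarrow> K * 0) at_bot" by (intro tendsto_intros exp_at_bot)
    hence "eventually (\<lambda>s. K * exp s < pohozaev t) at_bot" using pos by (auto dest: order_tendstoD)
    moreover have "eventually (\<lambda>s. s \<le> min 0 t) at_bot" by (rule eventually_le_at_bot)
    ultimately have "eventually (\<lambda>s::real. False) at_bot"
      by eventually_elim (use pohozaev_antimono upper in force)
    thus False by simp
  qed
  hence "pohozaev = (\<lambda>_. 0)" by auto
  with pohozaev_derivative have "pohozaev_deriv t0 = 0" using DERIV_unique DERIV_const by metis
  \<comment> \<open>The sign is flipped because \<open>integral_eq_0_iff\<close> is about
    nonnegative integrands.\<close>
  hence "cint (\<lambda>t \<theta>. (-1) * (exp (2*t) * Pt t \<theta> * exp (2 * U t \<theta>))) t0 = 0"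
    unfolding pohozaev_deriv_def by (subst cint_cmult[of "\<lambda>_. -1"]) simp
  moreover have "integral {0..2*pi} (\<lambda>\<theta>. (-1) * (exp (2*t0) * Pt t0 \<theta> * exp (2 * U t0 \<theta>))) = 0 \<longleftrightarrow>
      (\<forall>\<theta>\<in>{0..2*pi}. (-1) * (exp (2*t0) * Pt t0 \<theta> * exp (2 * U t0 \<theta>)) = 0)"
    using pohozaev_deriv_integrand_nonpos by (intro integral_eq_0_iff continuous_intros) auto
  ultimately show False using nontrivial by (auto simp: cint_def)
qed

lemma contradiction:
  assumes decay: "\<And>t \<theta>. t \<le> 0 \<Longrightarrow> \<bar>Ut t \<theta>\<bar> \<le> B * exp t"
    "\<And>t \<theta>. t \<le> 0 \<Longrightarrow> \<bar>P t \<theta>\<bar> \<le> B"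
    and nontrivial: "Pt t0 \<theta>0 \<noteq> 0" "\<theta>0 \<in> {0..2*pi}"
    and growth: "c > 0" "\<And>t. t \<ge> t1 \<Longrightarrow> cint (\<lambda>t \<theta>. \<bar>P t \<theta>\<bar>) t \<ge> c * exp (2*t)"
  shows False
proof -
  obtain T0 where T0: "pohozaev T0 < 0" using pohozaev_eventually_negative[OF decay nontrivial] by blast
  \<comment> \<open>The 1/100 is the threshold of \<open>small_oscillation\<close>; the other bound
    keeps the error \<open>2 * \<delta>\<close> below half of \<open>- pohozaev T0\<close>, and that
    half equals \<open>2 * pi * \<epsilon>\<close>.\<close>
  define \<delta> where "\<delta> = min (1/100) (- pohozaev T0 / 4)"
  define \<epsilon> where "\<epsilon> = - pohozaev T0 / (4 * pi)"
  have \<delta>: "\<delta> > 0" "\<delta> \<le> 1/100" "4 * \<delta> \<le> - pohozaev T0" and \<epsilon>: "\<epsilon> > 0"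
    using T0 by (auto simp: \<delta>_def \<epsilon>_def intro!: divide_neg_pos)
  \<comment> \<open>The running integrals of \<open>G\<close> are bounded, so after a time where
    they come within \<open>\<epsilon>\<close> of their supremum only mass \<open>\<epsilon>\<close>
    remains.\<close>
  obtain T1 where T1: "T1 \<ge> 0" "T1 \<ge> T0" "\<And>b. integral {T1..b} G \<le> \<epsilon>"
  proof -
    let ?I = "\<lambda>b. integral {0..b} G"
    have bdd: "bdd_above (?I ` {0..})" using integral_G_le by (auto intro!: bdd_aboveI)
    obtain b0 where b0: "b0 \<ge> 0" "?I b0 > (SUP b\<in>{0..}. ?I b) - \<epsilon>"
      using less_cSUP_iff[OF _ bdd, of "(SUP b\<in>{0..}. ?I b) - \<epsilon>"] \<epsilon> by auto
    show thesis
    proof (rule that[of "max b0 T0"])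
      fix b
      show "integral {max b0 T0..b} G \<le> \<epsilon>"
      proof (cases "max b0 T0 \<le> b")
        case True
        have "integral {max b0 T0..b} G \<le> integral {b0..b} G"
          using G_nonneg by (intro integral_subset_le G_integrable) auto
        also have "\<dots> = ?I b - ?I b0"
          using Henstock_Kurzweil_Integration.integral_combine[of 0 b0 b G] b0 True G_integrable by auto
        also have "?I b \<le> (SUP b\<in>{0..}. ?I b)" using True b0 by (intro cSUP_upper bdd) auto
        finally show ?thesis using b0(2) by linarith
      qed (use \<epsilon> in auto)
    qed (use b0 in auto)
  qed
  obtain s where s: "s \<ge> T1" "D s + G s < \<delta>" using good_times[OF \<delta>(1) T1(1)] by blast
  have "D s \<ge> 0" unfolding D_def using kap2_pos
    by (intro cint_nonneg jcontI continuous_intros) (auto simp: less_imp_le)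
  have m1s: "m1 s \<ge> -2 + \<epsilon> / 2"
  proof -
    \<comment> \<open>This is Jensen's inequality, obtained by integrating
      \<open>(Ut - m1)\<^sup>2 \<ge> 0\<close> around the circle.\<close>
    have "cint (\<lambda>t \<theta>. 2 * m1 t * Ut t \<theta> - (m1 t)\<^sup>2) s \<le> cint (\<lambda>t \<theta>. (Ut t \<theta>)\<^sup>2) s"
    proof (rule cint_mono; (intro jcontI continuous_intros)?)
      fix \<theta>
      show "2 * m1 s * Ut s \<theta> - (m1 s)\<^sup>2 \<le> (Ut s \<theta>)\<^sup>2"
        using zero_le_power2[of "Ut s \<theta> - m1 s"] by (simp add: power2_diff algebra_simps)
    qed
    moreover have "cint (\<lambda>t \<theta>. 2 * m1 t * Ut t \<theta> - (m1 t)\<^sup>2) s = 2 * pi * (m1 s)\<^sup>2"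
      by (subst cint_diff, (intro jcontI continuous_intros)+, subst cint_cmult)
         (simp add: cint_const m1_def power2_eq_square field_simps)
    moreover have "pohozaev s = cint (\<lambda>t \<theta>. (Ut t \<theta>)\<^sup>2) s - cint (\<lambda>t \<theta>. (Uh t \<theta>)\<^sup>2) s + cint g s + 2 * cint Ut s"
      unfolding pohozaev_def
      by (subst cint_add, (intro jcontI continuous_intros)+, subst cint_add, (intro jcontI continuous_intros)+,
          subst cint_diff, (intro jcontI continuous_intros)+, subst cint_cmult[of "\<lambda>_. 2"]) simp
    moreover have "cint Ut s = 2 * pi * m1 s" by (simp add: m1_def)
    moreover have "pohozaev s \<le> pohozaev T0" using s T1 by (intro pohozaev_antimono) auto
    moreover have "cint (\<lambda>t \<theta>. (Uh t \<theta>)\<^sup>2) s \<le> 2 * D s"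
      using s(2) G_nonneg[of s] \<delta> by (intro small_oscillation) auto
    ultimately have "2 * pi * ((m1 s)\<^sup>2 + 2 * m1 s) \<le> pohozaev T0 + 2 * \<delta>"
      using s(2) abs_cint_g[of s] G_nonneg[of s] \<open>D s \<ge> 0\<close> by (simp add: algebra_simps)
    also have "\<dots> \<le> pohozaev T0 / 2" using \<delta> by simp
    \<comment> \<open>This confines \<open>m1 s\<close> to the interval between -2 and 0. There
      \<open>- m1 s \<le> 2\<close>, so \<open>m1 s + 2\<close> is at least
      \<open>\<epsilon> / 2\<close>.\<close>
    finally have *: "(m1 s)\<^sup>2 + 2 * m1 s \<le> - \<epsilon>" by (simp add: \<epsilon>_def field_simps)
    show ?thesis
    proof (rule ccontr)
      assume "\<not> ?thesis"
      hence neg: "m1 s < -2 + \<epsilon> / 2" by simp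
      have "\<epsilon> \<le> 1"
        using * zero_le_power2[of "m1 s + 1"] by (simp add: power2_eq_square algebra_simps)
      show False
      proof (cases "m1 s + 2 \<ge> 0")
        case True
        have "(m1 s + 2) * (- m1 s) \<le> (m1 s + 2) * 2" using True by (intro mult_left_mono) auto
        with neg * show False by (simp add: power2_eq_square algebra_simps)
      next
        case False
        hence "(m1 s + 2) * m1 s > 0" by (intro mult_neg_neg) auto
        with * \<epsilon> show False by (simp add: power2_eq_square algebra_simps)
      qed
    qed
  qed
  \<comment> \<open>The remaining mass \<open>\<epsilon>\<close> changes \<open>m1\<close> by at
    most \<open>\<epsilon> / (2*pi)\<close>, less than \<open>\<epsilon> / 4\<close>, so half of the
    margin survives at all later times.\<close>
  have m1_ge: "m1 t \<ge> -2 + \<epsilon> / 4" if "t \<ge> s" for t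
  proof -
    have "2 * pi * (m1 t - m1 s) \<ge> - integral {s..t} G"
    proof -
      have up: "((\<lambda>t. 2 * pi * m2 t) has_integral (2 * pi * (m1 t - m1 s))) {s..t}"
        by (intro has_integral_mult_right m2_has_integral that)
      have low: "((\<lambda>t. - G t) has_integral - integral {s..t} G) {s..t}"
        by (intro has_integral_neg integrable_integral G_integrable)
      show ?thesis
      proof (rule has_integral_le[OF low up])
        fix x
        show "- G x \<le> 2 * pi * m2 x"
          using abs_cint_g[of x] by (simp add: m2_def cint_Utt abs_le_iff)
      qed
    qed
    moreover have "integral {s..t} G \<le> integral {T1..t} G"
      using s G_nonneg by (intro integral_subset_le G_integrable) auto
    ultimately have a: "2 * pi * (m1 t - m1 s) \<ge> - \<epsilon>" using T1(3)[of t] by linarith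
    have "m1 t - m1 s \<ge> - \<epsilon> / 4"
    proof (rule ccontr)
      assume "\<not> ?thesis"
      hence "m1 s - m1 t > \<epsilon> / 4" by simp
      hence "(2 * pi) * (m1 s - m1 t) > 4 * (\<epsilon> / 4)"
        using pi_gt3 \<epsilon> by (intro mult_strict_mono) auto
      with a show False by (simp add: algebra_simps)
    qed
    with m1s show ?thesis by simp
  qed
  have m_ge: "m t \<ge> m s + (-2 + \<epsilon> / 4) * (t - s)" if "t \<ge> s" for t
  proof -
    have "(\<lambda>t. m t - (-2 + \<epsilon> / 4) * (t - s)) s \<le> (\<lambda>t. m t - (-2 + \<epsilon> / 4) * (t - s)) t"
    proof (rule DERIV_nonneg_imp_nondecreasing[OF that])
      fix x assume "s \<le> x" "x \<le> t"
      moreover have "((\<lambda>t. m t - (-2 + \<epsilon> / 4) * (t - s)) has_real_derivative m1 x - (-2 + \<epsilon> / 4)) (at x)"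
        by (auto intro!: derivative_eq_intros m_derivatives)
      ultimately show "\<exists>y. ((\<lambda>t. m t - (-2 + \<epsilon> / 4) * (t - s)) has_real_derivative y) (at x) \<and> 0 \<le> y"
        using m1_ge[of x] by force
    qed
    thus ?thesis by simp
  qed
  \<comment> \<open>The constant part of an exponent in which \<open>2*t\<close> from the area
    factor and \<open>2*t\<close> from the growth of \<open>P\<close> offset the decay
    \<open>-4*t\<close> of twice the mean, leaving \<open>\<epsilon> / 2 * t\<close>. The -1 comes
    from \<open>V \<ge> -1\<close>.\<close>
  define A where "A = 2 * (m s - 1 + (2 - \<epsilon> / 4) * s)"
  have G_ge: "G t \<ge> c * exp (A + \<epsilon> / 2 * t)" if t: "t \<ge> s" "t \<ge> t1" "D t < 1/100" for t
  proof -
    have "c * exp (A + \<epsilon> / 2 * t) = exp (2*t + 2 * ((m s + (-2 + \<epsilon> / 4) * (t - s)) - 1)) * (c * exp (2*t))"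
    proof -
      have "A + \<epsilon> / 2 * t = (2*t + 2 * ((m s + (-2 + \<epsilon> / 4) * (t - s)) - 1)) + 2*t"
        by (simp add: A_def field_simps)
      thus ?thesis by (simp only: exp_add) (simp add: mult_ac)
    qed
    also have "\<dots> \<le> exp (2*t + 2 * (m t - 1)) * cint (\<lambda>t \<theta>. \<bar>P t \<theta>\<bar>) t"
      using m_ge[OF t(1)] growth t by (intro mult_mono) auto
    also have "\<dots> = cint (\<lambda>t \<theta>. exp (2*t + 2 * (m t - 1)) * \<bar>P t \<theta>\<bar>) t"
      by (simp add: cint_cmult)
    also have "\<dots> \<le> G t"
      unfolding G_def
    proof (rule cint_mono; (intro jcontI continuous_intros)?)
      fix \<theta> assume "\<theta> \<in> {0..2*pi}"
      hence "m t - 1 \<le> U t \<theta>" using small_oscillation(1)[OF t(3)] by (force simp: V_def)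
      hence "exp (2*t + 2 * (m t - 1)) * \<bar>P t \<theta>\<bar> \<le> exp (2*t + 2 * U t \<theta>) * \<bar>P t \<theta>\<bar>"
        by (intro mult_right_mono) auto
      thus "exp (2*t + 2 * (m t - 1)) * \<bar>P t \<theta>\<bar> \<le> \<bar>g t \<theta>\<bar>"
        by (simp add: g_def abs_mult exp_add mult_ac)
    qed
    finally show ?thesis .
  qed
  \<comment> \<open>Beyond the last bound the exponent is at least \<open>- ln c\<close>, so
    \<open>G \<ge> 1\<close> at almost radial times, where also
    \<open>G < \<delta> \<le> 1/100\<close>.\<close>
  define T where "T = max (max s t1) (2 * (- ln c - A) / \<epsilon>)"
  have "T \<ge> 0" using s T1 by (auto simp: T_def)
  then obtain t where t: "t \<ge> T" "D t + G t < \<delta>" using good_times[OF \<delta>(1)] by blast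
  have "t \<ge> 2 * (- ln c - A) / \<epsilon>" using t(1) by (simp add: T_def)
  hence "A + \<epsilon> / 2 * t \<ge> - ln c" using \<epsilon> by (simp add: field_simps)
  hence "c * exp (A + \<epsilon> / 2 * t) \<ge> c * exp (- ln c)" using growth by (intro mult_left_mono) auto
  also have "c * exp (- ln c) = 1" using growth by (simp add: exp_minus)
  finally have "1 \<le> c * exp (A + \<epsilon> / 2 * t)" .
  also have "D t \<ge> 0" unfolding D_def using kap2_pos
    by (intro cint_nonneg jcontI continuous_intros) (auto simp: less_imp_le)
  hence "c * exp (A + \<epsilon> / 2 * t) \<le> G t"
    using t G_nonneg[of t] \<delta> by (intro G_ge) (auto simp: T_def)
  finally show False using t(2) \<delta> \<open>D t \<ge> 0\<close> by linarith
qed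

end
section \<open>Passing to the cylinder\<close>

text \<open>As \<open>deriv\<close> is total, \<open>partial_deriv\<close> is meaningful only once a
  derivative is known to exist. Differentiability identifies it with the value of the derivative on
  an axis vector, and linearity does the rest.\<close>

lemma has_derivative_grad:
  fixes f :: "real ^ 'n \<Rightarrow> real"
  assumes "f differentiable (at x)"
  shows "(f has_derivative (\<lambda>h. h \<bullet> grad f x)) (at x)"
proof -
  obtain D where D: "(f has_derivative D) (at x)" using assms by (auto simp: differentiable_def)
  interpret bounded_linear D using D by (rule has_derivative_bounded_linear)
  have pd: "partial_deriv i f x = D (axis i 1)" for i
  proof -
    have "(f has_derivative D) (at (x + 0 *\<^sub>R axis i 1))" using D by simp
    moreover have "((\<lambda>t. x + t *\<^sub>R axis i (1::real)) has_derivative (\<lambda>t. t *\<^sub>R axis i 1)) (at 0)"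
      by (auto intro!: derivative_eq_intros)
    ultimately have "((\<lambda>t. f (x + t *\<^sub>R axis i 1)) has_derivative (\<lambda>t. D (t *\<^sub>R axis i 1))) (at 0)"
      using has_derivative_compose[of "\<lambda>t. x + t *\<^sub>R axis i (1::real)" _ 0 UNIV f D] by simp
    hence "((\<lambda>t. f (x + t *\<^sub>R axis i 1)) has_real_derivative D (axis i 1)) (at 0)"
      by (simp add: has_field_derivative_def scaleR mult.commute[of _ "D _"] lambda_one)
    thus ?thesis by (simp add: partial_deriv_def DERIV_imp_deriv)
  qed
  have "D = (\<lambda>h. h \<bullet> grad f x)"
  proof
    fix h
    have "D h = D (\<Sum>i\<in>UNIV. h $ i *\<^sub>R axis i 1)"
      using basis_expansion[of h] by (simp add: scalar_mult_eq_scaleR)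
    also have "\<dots> = (\<Sum>i\<in>UNIV. h $ i * D (axis i 1))" by (simp add: sum scaleR)
    finally show "D h = h \<bullet> grad f x" by (simp add: inner_vec_def grad_def pd)
  qed
  with D show ?thesis by simp
qed

lemma has_derivative_grad_curve:
  fixes f :: "real ^ 'n \<Rightarrow> real"
  assumes "f differentiable (at (c s))" "(c has_vector_derivative c') (at s)"
  shows "((\<lambda>s. f (c s)) has_real_derivative c' \<bullet> grad f (c s)) (at s)"
proof -
  have "((\<lambda>s. f (c s)) has_derivative (\<lambda>h. (h *\<^sub>R c') \<bullet> grad f (c s))) (at s)"
    using has_derivative_compose[of c "\<lambda>h. h *\<^sub>R c'" s UNIV f "\<lambda>h. h \<bullet> grad f (c s)"]
      has_derivative_grad[OF assms(1)] assms(2)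
    by (simp add: has_vector_derivative_def)
  thus ?thesis by (simp add: has_field_derivative_def mult.commute[of _ "c' \<bullet> _"] lambda_one)
qed

lemma has_partial_deriv:
  fixes f :: "real ^ 'n \<Rightarrow> real"
  assumes "f differentiable (at x)"
  shows "((\<lambda>t. f (x + t *\<^sub>R axis i 1)) has_real_derivative partial_deriv i f x) (at 0)"
proof -
  have "((\<lambda>t. x + t *\<^sub>R axis i (1::real)) has_vector_derivative axis i 1) (at 0)"
    by (auto intro!: derivative_eq_intros)
  from has_derivative_grad_curve[OF _ this, of f] assms show ?thesis
    by (simp add: inner_axis' grad_def)
qed

text \<open>The first argument is the logarithm of the radius, which makes the map conformal: the
  Laplacian turns into the flat one on the cylinder up to the factor
  \<open>exp (-2*t)\<close>.\<close>

definition pol :: "real \<Rightarrow> real \<Rightarrow> real ^ 2"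
  where "pol t \<theta> = vector [exp t * cos \<theta>, exp t * sin \<theta>]"

lemma pol_nth [simp]: "pol t \<theta> $ 1 = exp t * cos \<theta>" "pol t \<theta> $ 2 = exp t * sin \<theta>"
  by (simp_all add: pol_def)

lemma inner_2: "(x :: real ^ 2) \<bullet> y = x $ 1 * y $ 1 + x $ 2 * y $ 2"
  by (simp add: inner_vec_def sum_2)

lemma vec2_eqI: "x $ 1 = y $ 1 \<Longrightarrow> x $ 2 = y $ 2 \<Longrightarrow> (x :: 'a ^ 2) = y"
  by (simp add: vec_eq_iff forall_2)

lemma pol_eq: "pol t \<theta> = (exp t * cos \<theta>) *\<^sub>R axis 1 1 + (exp t * sin \<theta>) *\<^sub>R axis 2 1"
  by (rule vec2_eqI) (simp_all add: axis_def)

lemma norm_pol: "norm (pol t \<theta>) = exp t"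
proof -
  have "(norm (pol t \<theta>))\<^sup>2 = (exp t * cos \<theta>)\<^sup>2 + (exp t * sin \<theta>)\<^sup>2"
    unfolding power2_norm_eq_inner inner_2 by (simp add: power2_eq_square)
  also have "\<dots> = (exp t)\<^sup>2 * ((cos \<theta>)\<^sup>2 + (sin \<theta>)\<^sup>2)"
    by (simp only: power_mult_distrib distrib_left)
  finally show ?thesis by (simp add: power2_eq_iff_nonneg)
qed

lemma pol_surj:
  assumes "x \<noteq> 0"
  obtains t \<theta> where "x = pol t \<theta>" "\<theta> \<in> {0..2*pi}"
proof -
  define r where "r = norm x"
  have r: "r > 0" using assms by (simp add: r_def)
  have "(x $ 1 / r)\<^sup>2 + (x $ 2 / r)\<^sup>2 = ((x $ 1)\<^sup>2 + (x $ 2)\<^sup>2) / r\<^sup>2"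
    by (simp add: power_divide add_divide_distrib)
  also have "(x $ 1)\<^sup>2 + (x $ 2)\<^sup>2 = r\<^sup>2"
    unfolding r_def power2_norm_eq_inner inner_2 by (simp add: power2_eq_square)
  finally have "(x $ 1 / r)\<^sup>2 + (x $ 2 / r)\<^sup>2 = 1" using r by simp
  then obtain \<theta> where \<theta>: "0 \<le> \<theta>" "\<theta> < 2*pi" "x $ 1 / r = cos \<theta>" "x $ 2 / r = sin \<theta>"
    by (rule sincos_total_2pi)
  have "x = pol (ln r) \<theta>"
    by (rule vec2_eqI) (use r \<theta>(3,4)[symmetric] in simp_all)
  thus thesis using that \<theta> by auto
qed

lemma continuous_pol [continuous_intros]:
  fixes a b :: "'a :: t2_space \<Rightarrow> real"
  shows "continuous_on S a \<Longrightarrow> continuous_on S b \<Longrightarrow> continuous_on S (\<lambda>x. pol (a x) (b x))"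
  unfolding pol_eq by (intro continuous_intros)

lemma jcont_pol: "continuous_on UNIV f \<Longrightarrow> jcont (\<lambda>t \<theta>. f (pol t \<theta>))"
  by (rule jcontI, rule continuous_on_compose2[of UNIV f]) (auto intro!: continuous_intros)

lemma pol_derivatives:
  fixes f :: "real ^ 2 \<Rightarrow> real"
  assumes "f differentiable_on UNIV"
  shows "((\<lambda>t. f (pol t \<theta>)) has_real_derivative
      exp t * cos \<theta> * partial_deriv 1 f (pol t \<theta>) + exp t * sin \<theta> * partial_deriv 2 f (pol t \<theta>)) (at t)" (is ?t)
    and "((\<lambda>\<theta>. f (pol t \<theta>)) has_real_derivative
      - (exp t * sin \<theta>) * partial_deriv 1 f (pol t \<theta>) + exp t * cos \<theta> * partial_deriv 2 f (pol t \<theta>)) (at \<theta>)" (is ?h)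
proof -
  have f: "f differentiable (at x)" for x using assms by (simp add: differentiable_on_def)
  have "((\<lambda>t. pol t \<theta>) has_vector_derivative pol t \<theta>) (at t)"
    unfolding pol_eq by (auto intro!: derivative_eq_intros simp: mult.commute)
  from has_derivative_grad_curve[OF f this] show ?t by (simp add: inner_2 grad_def)
  have "((\<lambda>\<theta>. pol t \<theta>) has_vector_derivative
      (- (exp t * sin \<theta>)) *\<^sub>R axis 1 1 + (exp t * cos \<theta>) *\<^sub>R axis 2 1) (at \<theta>)"
    unfolding pol_eq by (auto intro!: derivative_eq_intros simp: mult.commute)
  from has_derivative_grad_curve[OF f this] show ?h
    by (simp add: inner_2 grad_def axis_def)
qed

section \<open>Polynomials on rays and circles\<close>

lemma real_polynomial_function_partial_deriv:
  fixes p :: "real ^ 'n \<Rightarrow> real"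
  assumes "real_polynomial_function p"
  shows "real_polynomial_function (partial_deriv i p)"
  using assms
proof (induction rule: real_polynomial_function.induct)
  case (linear f)
  then interpret bounded_linear f .
  have "partial_deriv i f x = f (axis i 1)" for x
    unfolding partial_deriv_def
    by (rule DERIV_imp_deriv) (auto simp: add scaleR intro!: derivative_eq_intros)
  hence "partial_deriv i f = (\<lambda>_. f (axis i 1))" by auto
  thus ?case by auto
next
  case (const c)
  have "partial_deriv i (\<lambda>_. c) = (\<lambda>_. 0)" by (auto simp: partial_deriv_def)
  thus ?case by auto
next
  case (add f g)
  note fd = has_partial_deriv[OF differentiable_at_real_polynomial_function]
  have "partial_deriv i (\<lambda>x. f x + g x) = (\<lambda>x. partial_deriv i f x + partial_deriv i g x)"
    unfolding fun_eq_iff partial_deriv_def[of i "\<lambda>x. f x + g x"]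
    by (intro allI DERIV_imp_deriv DERIV_add fd add.hyps)
  thus ?case using add by auto
next
  case (mult f g)
  note fd = has_partial_deriv[OF differentiable_at_real_polynomial_function]
  have "partial_deriv i (\<lambda>x. f x * g x) = (\<lambda>x. f x * partial_deriv i g x + partial_deriv i f x * g x)"
    unfolding fun_eq_iff partial_deriv_def[of i "\<lambda>x. f x * g x"]
    by (auto intro!: DERIV_imp_deriv derivative_eq_intros fd mult.hyps)
  thus ?case using mult by auto
qed

text \<open>The uniform degree bound and the continuous coefficients are what permits integration
  over \<open>\<theta>\<close> coefficient by coefficient.\<close>

lemma polynomial_on_rays:
  fixes p :: "real ^ 2 \<Rightarrow> real"
  assumes "real_polynomial_function p"
  shows "\<exists>Q N. (\<forall>\<theta>. degree (Q \<theta>) \<le> N) \<and> (\<forall>j. continuous_on UNIV (\<lambda>\<theta>. coeff (Q \<theta>) j)) \<and>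
    (\<forall>r \<theta>. p (r *\<^sub>R pol 0 \<theta>) = poly (Q \<theta>) r)"
  using assms
proof (induction rule: real_polynomial_function.induct)
  case (linear f)
  then interpret bounded_linear f .
  have "continuous_on UNIV (\<lambda>\<theta>. f (pol 0 \<theta>))"
    by (intro continuous_on continuous_intros)
  moreover have *: "(\<lambda>\<theta>. coeff [:0, f (pol 0 \<theta>):] j) = (if j = 1 then \<lambda>\<theta>. f (pol 0 \<theta>) else (\<lambda>_. 0))" for j
    by (auto simp: coeff_pCons split: nat.split)
  ultimately have "continuous_on UNIV (\<lambda>\<theta>. coeff [:0, f (pol 0 \<theta>):] j)" for j
    unfolding * by (auto split: if_splits)
  thus ?case
    by (intro exI[of _ "\<lambda>\<theta>. [:0, f (pol 0 \<theta>):]"] exI[of _ 1]) (auto simp: scaleR)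
next
  case (const c)
  show ?case by (intro exI[of _ "\<lambda>_. [:c:]"] exI[of _ 0]) auto
next
  case (add f g)
  then obtain Q1 N1 Q2 N2 where
    "\<And>\<theta>. degree (Q1 \<theta>) \<le> N1" "\<And>j. continuous_on UNIV (\<lambda>\<theta>. coeff (Q1 \<theta>) j)" "\<And>r \<theta>. f (r *\<^sub>R pol 0 \<theta>) = poly (Q1 \<theta>) r"
    "\<And>\<theta>. degree (Q2 \<theta>) \<le> N2" "\<And>j. continuous_on UNIV (\<lambda>\<theta>. coeff (Q2 \<theta>) j)" "\<And>r \<theta>. g (r *\<^sub>R pol 0 \<theta>) = poly (Q2 \<theta>) r"
    by metis
  moreover from this have "degree (Q1 \<theta> + Q2 \<theta>) \<le> max N1 N2" for \<theta>
    by (intro degree_add_le) (auto intro: max.coboundedI1 max.coboundedI2)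
  ultimately show ?case
    by (intro exI[of _ "\<lambda>\<theta>. Q1 \<theta> + Q2 \<theta>"] exI[of _ "max N1 N2"])
       (auto intro!: continuous_intros)
next
  case (mult f g)
  then obtain Q1 N1 Q2 N2 where
    Q: "\<And>\<theta>. degree (Q1 \<theta>) \<le> N1" "\<And>j. continuous_on UNIV (\<lambda>\<theta>. coeff (Q1 \<theta>) j)" "\<And>r \<theta>. f (r *\<^sub>R pol 0 \<theta>) = poly (Q1 \<theta>) r"
    "\<And>\<theta>. degree (Q2 \<theta>) \<le> N2" "\<And>j. continuous_on UNIV (\<lambda>\<theta>. coeff (Q2 \<theta>) j)" "\<And>r \<theta>. g (r *\<^sub>R pol 0 \<theta>) = poly (Q2 \<theta>) r"
    by metis
  have "degree (Q1 \<theta> * Q2 \<theta>) \<le> N1 + N2" for \<theta>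
    using degree_mult_le[of "Q1 \<theta>" "Q2 \<theta>"] Q(1,4)[of \<theta>] by linarith
  thus ?case
    by (intro exI[of _ "\<lambda>\<theta>. Q1 \<theta> * Q2 \<theta>"] exI[of _ "N1 + N2"])
       (auto simp: coeff_mult Q(3,6) intro!: continuous_intros Q(2,5))
qed

text \<open>The identity covers negative \<open>r\<close> too, so that a sign known for
  \<open>p\<close> carries over to \<open>q\<close> on both sides of 0.\<close>

lemma circle_integral_polynomial:
  fixes p :: "real ^ 2 \<Rightarrow> real"
  assumes "real_polynomial_function p"
  obtains q where "\<And>r. integral {0..2*pi} (\<lambda>\<theta>. p (r *\<^sub>R pol 0 \<theta>)) = poly q r"
proof -
  obtain Q N where Q: "\<And>\<theta>. degree (Q \<theta>) \<le> N" "\<And>j. continuous_on UNIV (\<lambda>\<theta>. coeff (Q \<theta>) j)"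
    "\<And>r \<theta>. p (r *\<^sub>R pol 0 \<theta>) = poly (Q \<theta>) r"
    using polynomial_on_rays[OF assms] by blast
  have cQ: "continuous_on S (\<lambda>\<theta>. coeff (Q \<theta>) j)" for S j
    using Q(2) by (rule continuous_on_subset) auto
  define q where "q = (\<Sum>j\<le>N. monom (integral {0..2*pi} (\<lambda>\<theta>. coeff (Q \<theta>) j)) j)"
  have "integral {0..2*pi} (\<lambda>\<theta>. p (r *\<^sub>R pol 0 \<theta>)) = poly q r" for r
  proof -
    have "poly (Q \<theta>) r = (\<Sum>j\<le>N. coeff (Q \<theta>) j * r ^ j)" for \<theta>
      unfolding poly_altdef using Q(1)[of \<theta>]
      by (intro sum.mono_neutral_left) (auto simp: coeff_eq_0)
    hence "integral {0..2*pi} (\<lambda>\<theta>. p (r *\<^sub>R pol 0 \<theta>)) = (\<Sum>j\<le>N. integral {0..2*pi} (\<lambda>\<theta>. coeff (Q \<theta>) j * r ^ j))"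
      unfolding Q(3) by (simp only:) (intro integral_sum integrable_continuous_real continuous_intros cQ finite_atMost)
    also have "\<dots> = poly q r"
      by (simp add: q_def poly_sum poly_monom)
    finally show ?thesis .
  qed
  thus thesis using that by blast
qed

text \<open>A nonnegative polynomial vanishing at \<open>0\<close> vanishes there to second order.\<close>

lemma nonneg_poly_quadratic_growth:
  fixes s :: "real poly"
  assumes nonneg: "\<And>r. poly s r \<ge> 0" and "poly s 0 = 0" "s \<noteq> 0"
  shows "\<exists>c>0. \<exists>r0. \<forall>r\<ge>r0. poly s r \<ge> c * r\<^sup>2"
proof -
  obtain s1 where s1: "s = [:0, 1:] * s1"
    using assms(2) by (metis dvdE poly_eq_0_iff_dvd neg_0_equal_iff_equal)
  \<comment> \<open>Nonnegativity of \<open>s\<close> forces its cofactor \<open>s1\<close> to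
    switch sign at 0, hence to vanish there by continuity.\<close>
  have "poly s1 0 = 0"
  proof -
    have sgn: "x < 0 \<Longrightarrow> poly s1 x \<le> 0" "x > 0 \<Longrightarrow> poly s1 x \<ge> 0" for x
      using nonneg[of x] by (auto simp: s1 zero_le_mult_iff)
    have "isCont (poly s1) 0" by simp
    hence lim: "(poly s1 \<longlongrightarrow> poly s1 0) (at_left 0)" "(poly s1 \<longlongrightarrow> poly s1 0) (at_right 0)"
      by (auto simp: isCont_def filterlim_at_split)
    have "eventually (\<lambda>x. poly s1 x \<le> 0) (at_left 0)"
      using sgn by (auto simp: eventually_at_filter)
    hence "poly s1 0 \<le> 0" by (intro tendsto_upperbound[OF lim(1)]) auto
    moreover have "eventually (\<lambda>x. poly s1 x \<ge> 0) (at_right 0)"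
      using sgn by (auto simp: eventually_at_filter)
    hence "poly s1 0 \<ge> 0" by (intro tendsto_lowerbound[OF lim(2)]) auto
    ultimately show ?thesis by simp
  qed
  then obtain s2 where s2: "s1 = [:0, 1:] * s2"
    by (metis dvdE poly_eq_0_iff_dvd neg_0_equal_iff_equal)
  have s: "poly s r = r\<^sup>2 * poly s2 r" for r by (simp add: s1 s2 power2_eq_square)
  have "s2 \<noteq> 0" using assms(3) s1 s2 by auto
  have "lead_coeff s2 > 0"
  proof (rule ccontr)
    assume "\<not> ?thesis"
    hence "lead_coeff (- s2) > 0" using \<open>s2 \<noteq> 0\<close> by (simp add: lead_coeff_minus less_le)
    then obtain n where n: "\<And>x. x \<ge> n \<Longrightarrow> poly (- s2) x \<ge> lead_coeff (- s2)"
      using poly_pinfty_gt_lc[of "- s2"] by blast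
    have "poly s2 (max n 1) < 0" using n[of "max n 1"] \<open>lead_coeff (- s2) > 0\<close> by simp
    moreover have "(max n 1)\<^sup>2 > 0" by (simp add: max_def)
    ultimately have "(max n 1)\<^sup>2 * poly s2 (max n 1) < 0" by (rule mult_pos_neg[rotated])
    with nonneg[of "max n 1"] show False by (simp add: s)
  qed
  then obtain n where n: "\<And>x. x \<ge> n \<Longrightarrow> poly s2 x \<ge> lead_coeff s2"
    using poly_pinfty_gt_lc[of s2] by blast
  have "poly s r \<ge> lead_coeff s2 * r\<^sup>2" if "r \<ge> n" for r
    using mult_left_mono[OF n[OF that], of "r\<^sup>2"] by (simp add: s mult.commute)
  with \<open>lead_coeff s2 > 0\<close> show ?thesis by blast
qed

section \<open>Integration in polar coordinates\<close>

lemma polar_mass_le: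
  fixes f :: "real ^ 2 \<Rightarrow> real"
  assumes f: "continuous_on UNIV f" "\<And>x. f x \<ge> 0" "integrable lborel f" and T: "T \<ge> 0"
  shows "integral {0..T} (cint (\<lambda>t \<theta>. exp (2*t) * f (pol t \<theta>))) \<le> integral\<^sup>L lborel f"
proof -
  define a b :: "real ^ 2" where "a = vector [0, 0]" and "b = vector [T, 2*pi]"
  define F :: "real ^ 2 \<Rightarrow> real ^ 2" where "F x = pol (x $ 1) (x $ 2)" for x
  define F' :: "real ^ 2 \<Rightarrow> real ^ 2 \<Rightarrow> real ^ 2" where
    "F' x h = (exp (x $ 1) * (h $ 1 * cos (x $ 2) - h $ 2 * sin (x $ 2))) *\<^sub>R axis 1 1
            + (exp (x $ 1) * (h $ 1 * sin (x $ 2) + h $ 2 * cos (x $ 2))) *\<^sub>R axis 2 1" for x h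
  define k :: "real ^ 2 \<Rightarrow> real" where "k x = exp (2 * x $ 1) * f (F x)" for x
  have F': "(F has_derivative F' x) (at x within S)" for x S
    unfolding F_def[abs_def] F'_def[abs_def] pol_eq
    by (auto intro!: derivative_eq_intros bounded_linear_imp_has_derivative[OF bounded_linear_vec_nth]
        simp: algebra_simps)
  have det: "\<bar>det (matrix (F' x))\<bar> = exp (2 * x $ 1)" for x
  proof -
    have "det (matrix (F' x)) = (exp (x $ 1))\<^sup>2 * (cos (x $ 2))\<^sup>2 + (exp (x $ 1))\<^sup>2 * (sin (x $ 2))\<^sup>2"
      unfolding det_2 matrix_def
      by (simp add: F'_def axis_def power2_eq_square algebra_simps)
    also have "\<dots> = (exp (x $ 1))\<^sup>2"
      by (simp only: distrib_left[symmetric] sin_cos_squared_add2 mult_1_right)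
    finally show ?thesis by (simp add: exp_double)
  qed
  \<comment> \<open>In the open box two angles differ by less than \<open>2*pi\<close>, so equal
    sine and cosine force equal angles.\<close>
  have inj: "inj_on F (box a b)"
  proof (rule inj_onI)
    fix x y assume xy: "x \<in> box a b" "y \<in> box a b" "F x = F y"
    have 1: "x $ 1 = y $ 1"
      using arg_cong[OF xy(3), of norm] by (simp add: F_def norm_pol)
    have "F x $ 1 = F y $ 1" "F x $ 2 = F y $ 2" using xy(3) by auto
    hence "sin (x $ 2) = sin (y $ 2) \<and> cos (x $ 2) = cos (y $ 2)"
      by (simp add: F_def 1)
    then obtain n :: int where n: "x $ 2 = y $ 2 + 2 * pi * n" using sin_cos_eq_iff by blast
    have "\<bar>x $ 2 - y $ 2\<bar> < 2 * pi"
      using xy(1,2) by (auto simp: mem_box_cart a_def b_def forall_2 abs_less_iff)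
    hence "2 * pi * \<bar>real_of_int n\<bar> < 2 * pi * 1" by (simp add: n abs_mult)
    hence "\<bar>real_of_int n\<bar> < 1" using pi_gt_zero by (simp only: mult_less_cancel_left_pos)
    hence "n = 0" by linarith
    thus "x = y" using 1 n by (intro vec2_eqI) auto
  qed
  have cF: "continuous_on S F" for S
    unfolding F_def by (intro continuous_intros)
  have ck: "continuous_on S k" for S
    unfolding k_def[abs_def]
    by (intro continuous_intros continuous_on_compose2[OF f(1)] cF) auto
  have "k absolutely_integrable_on cbox a b"
    by (rule absolutely_integrable_continuous[OF ck])
  hence kb: "k absolutely_integrable_on box a b"
    by (rule set_integrable_subset) (auto simp: box_subset_cbox)
  \<comment> \<open>The integrand is wrapped into \<open>real ^ 1\<close> because the change of
    variables theorem concerns vector-valued functions.\<close>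
  have *: "(\<lambda>x. vec (f x) :: real ^ 1) absolutely_integrable_on (F ` box a b) \<and>
      integral (F ` box a b) (\<lambda>x. vec (f x) :: real ^ 1) = vec (integral (box a b) k)"
  proof (rule has_absolute_integral_change_of_variables[THEN iffD1, OF _ F' inj])
    show "box a b \<in> sets lebesgue" by simp
    show "(\<lambda>x. \<bar>det (matrix (F' x))\<bar> *\<^sub>R (vec (f (F x)) :: real ^ 1)) absolutely_integrable_on box a b \<and>
      integral (box a b) (\<lambda>x. \<bar>det (matrix (F' x))\<bar> *\<^sub>R (vec (f (F x)) :: real ^ 1)) = vec (integral (box a b) k)"
      using kb unfolding absolutely_integrable_on_1_iff integral_on_1_eq
      by (simp add: det k_def[abs_def] vec_eq_iff)
  qed
  have "integral (cbox a b) k = integral (box a b) k" by (simp add: integral_open_interval)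
  also have "\<dots> = integral (F ` box a b) f"
    using * unfolding integral_on_1_eq by (simp add: vec_eq_iff)
  also have "\<dots> \<le> integral UNIV f"
    using * f has_integral_integral_lborel[OF f(3)]
    by (intro integral_subset_le)
       (auto simp: absolutely_integrable_on_1_iff absolutely_integrable_on_def)
  also have "\<dots> = integral\<^sup>L lborel f"
    using has_integral_integral_lborel[OF f(3)] by (rule integral_unique)
  finally have le: "integral (cbox a b) k \<le> integral\<^sup>L lborel f" .
  \<comment> \<open>Fubini's theorem is available on \<open>real \<times> real\<close>;
    \<open>u\<close> and \<open>v\<close> identify that space with \<open>real ^ 2\<close> and
    preserve the content of boxes.\<close>
  define u :: "real \<times> real \<Rightarrow> real ^ 2" where "u z = vector [fst z, snd z]" for z
  define v :: "real ^ 2 \<Rightarrow> real \<times> real" where "v x = (x $ 1, x $ 2)" for x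
  have uv: "u (v x) = x" "v (u z) = z" for x z
    by (auto simp: u_def v_def intro: vec2_eqI)
  have v_box: "v ` cbox c d = cbox (v c) (v d)" for c d
  proof (intro equalityI subsetI)
    fix z assume "z \<in> cbox (v c) (v d)"
    hence "u z \<in> cbox c d" by (cases z) (auto simp: u_def v_def mem_box_cart forall_2 cbox_Pair_eq)
    thus "z \<in> v ` cbox c d" using uv(2)[of z] by (metis imageI)
  qed (auto simp: v_def mem_box_cart forall_2 cbox_Pair_eq)
  have u_box: "u ` cbox c d = cbox (u c) (u d)" for c d
    using v_box[of "u c" "u d"] uv by (metis (no_types, lifting) image_cong image_ident image_image)
  have "continuous_on UNIV u"
  proof -
    have "u z = fst z *\<^sub>R axis 1 1 + snd z *\<^sub>R axis 2 1" for z
      by (rule vec2_eqI) (simp_all add: u_def axis_def)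
    thus ?thesis by (simp add: continuous_intros)
  qed
  hence cu: "continuous (at z) u" for z using continuous_on_eq_continuous_at[OF open_UNIV] by blast
  have content: "measure lborel (u ` cbox c d) = 1 * measure lborel (cbox c d)" for c d
  proof (cases "cbox c d = {}")
    case False
    hence "u ` cbox c d \<noteq> {}" by simp
    hence "measure lborel (u ` cbox c d) = (fst d - fst c) * (snd d - snd c)"
      unfolding u_box by (subst content_cbox_cart) (auto simp: u_def UNIV_2)
    moreover have "fst c \<le> fst d" "snd c \<le> snd d" using False
      by (cases c; cases d; auto simp: cbox_Pair_eq)+
    hence "measure lborel (cbox c d) = (fst d - fst c) * (snd d - snd c)"
      by (cases c; cases d) (simp add: content_Pair)
    ultimately show ?thesis by simp
  qed auto
  have ex_box: "\<exists>w z. u ` cbox c d = cbox w z" "\<exists>w z. v ` cbox c' d' = cbox w z" for c d c' d'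
    using u_box v_box by blast+
  have "((\<lambda>z. k (u z)) has_integral (1 / 1) *\<^sub>R integral (cbox a b) k) (v ` cbox a b)"
  proof (rule has_integral_twiddle[OF _ uv(2) uv(1) cu ex_box content])
    show "(k has_integral integral (cbox a b) k) (cbox a b)"
      by (intro integrable_integral integrable_continuous ck)
  qed simp
  moreover have va: "v a = (0, 0)" and vb: "v b = (T, 2*pi)"
    by (simp_all add: v_def a_def b_def)
  ultimately have "integral (cbox (0, 0) (T, 2*pi)) (\<lambda>z. k (u z)) = integral (cbox a b) k"
    unfolding v_box by (simp add: va vb integral_unique)
  moreover have "integral (cbox (0, 0) (T, 2*pi)) (\<lambda>z. k (u z))
      = integral (cbox 0 T) (\<lambda>t. integral (cbox 0 (2*pi)) (\<lambda>\<theta>. k (u (t, \<theta>))))"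
    by (intro integral_prod_continuous continuous_on_compose2[OF ck])
       (use \<open>continuous_on UNIV u\<close> continuous_on_subset in blast)+
  ultimately show ?thesis using le
    by (simp add: k_def u_def F_def cint_def[abs_def])
qed

text \<open>The mean value theorem on the segment from 0 to \<open>x\<close> gives
  \<open>y = z *\<^sub>R x\<close> with \<open>y \<bullet> grad p y = z * (p x - p 0)\<close> and
  \<open>z > 0\<close>. This yields both the maximality of \<open>p 0\<close> and a point where the
  radial derivative is nonzero.\<close>

lemma ray_mean_value:
  fixes p :: "real ^ 'n \<Rightarrow> real"
  assumes "p differentiable_on UNIV"
  shows "\<exists>y. y \<bullet> grad p y * (p x - p 0) \<ge> 0 \<and> (y \<bullet> grad p y = 0 \<longleftrightarrow> p x = p 0)"
proof -
  have d: "p differentiable (at y)" for y using assms by (simp add: differentiable_on_def)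
  have "((\<lambda>s. s *\<^sub>R x) has_vector_derivative x) (at s)" for s
    by (auto intro!: derivative_eq_intros)
  from has_derivative_grad_curve[OF d this]
  have *: "((\<lambda>s. p (s *\<^sub>R x)) has_real_derivative x \<bullet> grad p (s *\<^sub>R x)) (at s)" for s .
  obtain z where z: "0 < z" "z < 1" "p (1 *\<^sub>R x) - p (0 *\<^sub>R x) = (1 - 0) * (x \<bullet> grad p (z *\<^sub>R x))"
    using MVT2[of 0 1 "\<lambda>s. p (s *\<^sub>R x)" "\<lambda>s. x \<bullet> grad p (s *\<^sub>R x)"] * by auto
  show ?thesis
    by (rule exI[of _ "z *\<^sub>R x"]) (use z in \<open>auto simp: mult_ac\<close>)
qed

text \<open>The circle integral of \<open>p 0 - p\<close> is a nonnegative, nonzero polynomial in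
  the radius vanishing at 0, hence grows at least quadratically. Passing to
  \<open>\<bar>p\<bar>\<close> costs only the constant \<open>K\<close>.\<close>

lemma circle_integral_growth:
  fixes p :: "real ^ 2 \<Rightarrow> real"
  assumes p: "real_polynomial_function p" and le: "\<And>x. p x \<le> p 0" and x0: "p x0 \<noteq> p 0"
  shows "\<exists>c>0. \<exists>t1. \<forall>t\<ge>t1. c * exp (2*t) \<le> cint (\<lambda>t \<theta>. \<bar>p (pol t \<theta>)\<bar>) t"
proof -
  have cp: "continuous_on S p" for S
    by (intro differentiable_imp_continuous_on differentiable_on_real_polynomial_function p)
  have pol_r: "pol t \<theta> = exp t *\<^sub>R pol 0 \<theta>" for t \<theta> by (rule vec2_eqI) simp_all
  have cr: "continuous_on S (\<lambda>\<theta>. p (r *\<^sub>R pol 0 \<theta>))" for S :: "real set" and r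
    by (rule continuous_on_compose2[OF cp[of UNIV]]) (auto intro!: continuous_intros)
  have "real_polynomial_function (\<lambda>x. p 0 - p x)" using p by auto
  then obtain q where q: "\<And>r. integral {0..2*pi} (\<lambda>\<theta>. p 0 - p (r *\<^sub>R pol 0 \<theta>)) = poly q r"
    using circle_integral_polynomial[of "\<lambda>x. p 0 - p x"] by metis
  have "q \<noteq> 0"
  proof
    assume "q = 0"
    have "x0 \<noteq> 0" using x0 by auto
    then obtain t \<theta> where x0_eq: "x0 = pol t \<theta>" "\<theta> \<in> {0..2*pi}" by (rule pol_surj)
    have "integral {0..2*pi} (\<lambda>\<theta>. p 0 - p (exp t *\<^sub>R pol 0 \<theta>)) = 0" by (simp add: q \<open>q = 0\<close>)
    moreover have "integral {0..2*pi} (\<lambda>\<theta>. p 0 - p (exp t *\<^sub>R pol 0 \<theta>)) = 0 \<longleftrightarrow>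
        (\<forall>\<theta>\<in>{0..2*pi}. p 0 - p (exp t *\<^sub>R pol 0 \<theta>) = 0)"
      by (intro integral_eq_0_iff continuous_intros cr) (use le in auto)
    ultimately have "p 0 - p (exp t *\<^sub>R pol 0 \<theta>) = 0" using x0_eq(2) by blast
    thus False using x0 x0_eq(1) pol_r[of t \<theta>] by simp
  qed
  moreover have "poly q r \<ge> 0" for r
    unfolding q[symmetric] using le
    by (intro integral_nonneg integrable_continuous_real continuous_intros cr) auto
  moreover have "poly q 0 = 0" unfolding q[symmetric] by simp
  ultimately obtain c r0 where c: "c > 0" "\<And>r. r \<ge> r0 \<Longrightarrow> poly q r \<ge> c * r\<^sup>2"
    using nonneg_poly_quadratic_growth[of q] by blast
  define K where "K = 2 * pi * \<bar>p 0\<bar>"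
  \<comment> \<open>From \<open>t1\<close> on, \<open>exp t\<close> is at least 1, \<open>r0\<close>
    and \<open>2 * K / c\<close>, so \<open>K\<close> is absorbed by half of
    \<open>c * exp (2*t)\<close>.\<close>
  define t1 where "t1 = ln (max 1 (max r0 (2 * K / c)))"
  have "c / 2 * exp (2*t) \<le> cint (\<lambda>t \<theta>. \<bar>p (pol t \<theta>)\<bar>) t" if "t \<ge> t1" for t
  proof -
    have "max 1 (max r0 (2 * K / c)) = exp t1" unfolding t1_def by (rule exp_ln[symmetric]) linarith
    moreover have "exp t1 \<le> exp t" using that by simp
    ultimately have e: "exp t \<ge> 1" "exp t \<ge> r0" "exp t \<ge> 2 * K / c" by linarith+
    have "exp t * 1 \<le> exp t * exp t" using e by (intro mult_left_mono) auto
    hence "2 * K / c \<le> (exp t)\<^sup>2" using e(3) unfolding power2_eq_square by linarith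
    hence K: "K \<le> c / 2 * (exp t)\<^sup>2" using c by (simp add: field_simps)
    have "c * (exp t)\<^sup>2 \<le> poly q (exp t)" by (rule c(2)[OF e(2)])
    also have "\<dots> \<le> integral {0..2*pi} (\<lambda>\<theta>. \<bar>p 0\<bar> + \<bar>p (exp t *\<^sub>R pol 0 \<theta>)\<bar>)"
      unfolding q[symmetric]
      by (intro integral_le integrable_continuous_real continuous_intros cr) (auto simp: abs_if)
    also have "\<dots> = K + integral {0..2*pi} (\<lambda>\<theta>. \<bar>p (exp t *\<^sub>R pol 0 \<theta>)\<bar>)"
      by (subst Henstock_Kurzweil_Integration.integral_add)
         (auto simp: K_def intro!: integrable_continuous_real continuous_intros cr)
    also have "integral {0..2*pi} (\<lambda>\<theta>. \<bar>p (exp t *\<^sub>R pol 0 \<theta>)\<bar>) = cint (\<lambda>t \<theta>. \<bar>p (pol t \<theta>)\<bar>) t"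
      by (simp only: cint_def pol_r[of t])
    finally show ?thesis using K by (simp add: exp_double)
  qed
  thus ?thesis using c(1) by (intro exI[of _ "c/2"]) auto
qed

lemma bounded_near_origin:
  fixes f :: "real ^ 2 \<Rightarrow> real"
  assumes "continuous_on UNIV f"
  shows "\<exists>B. \<forall>t\<le>0. \<forall>\<theta>. \<bar>f (pol t \<theta>)\<bar> \<le> B"
proof -
  have "compact (f ` cball 0 1)"
    using assms by (intro compact_continuous_image) (auto intro: continuous_on_subset)
  then obtain B where "\<And>y. y \<in> f ` cball 0 1 \<Longrightarrow> norm y \<le> B"
    using compact_imp_bounded bounded_iff by metis
  moreover have "pol t \<theta> \<in> cball 0 1" if "t \<le> 0" for t \<theta>
    using that by (simp add: norm_pol)
  ultimately show ?thesis by fastforce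
qed

section \<open>A solution in the plane viewed on the cylinder\<close>

theorem theorem1p2:
  fixes p :: "real ^ 2 \<Rightarrow> real"
  assumes "real_polynomial_function p"
    and "\<nexists>c. \<forall>x. p x = c"
    and "\<forall>x. x \<bullet> grad p x \<le> 0"
  shows "\<nexists>u :: real ^ 2 \<Rightarrow> real.
           smooth u \<and>
           (\<forall>x. - laplacian u x = p x * exp (2 * u x)) \<and>
           (\<exists>C. \<forall>x. u x \<le> C) \<and>
           integrable lborel (\<lambda>x. \<bar>p x\<bar> * exp (2 * u x))"
proof
  assume "\<exists>u :: real ^ 2 \<Rightarrow> real. smooth u \<and>
           (\<forall>x. - laplacian u x = p x * exp (2 * u x)) \<and>
           (\<exists>C. \<forall>x. u x \<le> C) \<and>
           integrable lborel (\<lambda>x. \<bar>p x\<bar> * exp (2 * u x))"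
  then obtain u :: "real ^ 2 \<Rightarrow> real" and C where
    smooth: "smooth u" and eq: "\<And>x. - laplacian u x = p x * exp (2 * u x)" and
    C: "\<And>x. u x \<le> C" and int: "integrable lborel (\<lambda>x. \<bar>p x\<bar> * exp (2 * u x))" by blast
  have Ck: "Ck (Suc (Suc 0)) u" "Ck (Suc 0) u" "Ck 0 u" using smooth by (auto simp: smooth_def)
  have du: "u differentiable_on UNIV" and da: "\<And>i. partial_deriv i u differentiable_on UNIV"
    and cu: "continuous_on UNIV u" "\<And>i. continuous_on UNIV (partial_deriv i u)"
      "\<And>i j. continuous_on UNIV (partial_deriv j (partial_deriv i u))"
    using Ck by auto
  have dp: "p differentiable_on UNIV" and cp: "continuous_on UNIV p"
      "\<And>i. continuous_on UNIV (partial_deriv i p)"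
    by (intro differentiable_imp_continuous_on differentiable_on_real_polynomial_function
        real_polynomial_function_partial_deriv assms(1))+

  define A where "A i t \<theta> = partial_deriv i u (pol t \<theta>)" for i t \<theta>
  define H where "H i j t \<theta> = partial_deriv j (partial_deriv i u) (pol t \<theta>)" for i j t \<theta>
  define U where "U t \<theta> = u (pol t \<theta>)" for t \<theta>
  define Ut where "Ut t \<theta> = exp t * cos \<theta> * A 1 t \<theta> + exp t * sin \<theta> * A 2 t \<theta>" for t \<theta>
  define Uh where "Uh t \<theta> = - (exp t * sin \<theta>) * A 1 t \<theta> + exp t * cos \<theta> * A 2 t \<theta>" for t \<theta>
  define At where "At i t \<theta> = exp t * cos \<theta> * H i 1 t \<theta> + exp t * sin \<theta> * H i 2 t \<theta>" for i t \<theta>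
  define Ah where "Ah i t \<theta> = - (exp t * sin \<theta>) * H i 1 t \<theta> + exp t * cos \<theta> * H i 2 t \<theta>" for i t \<theta>
  define Utt where "Utt t \<theta> = Ut t \<theta> + exp t * cos \<theta> * At 1 t \<theta> + exp t * sin \<theta> * At 2 t \<theta>" for t \<theta>
  define Uht where "Uht t \<theta> = Uh t \<theta> - exp t * sin \<theta> * At 1 t \<theta> + exp t * cos \<theta> * At 2 t \<theta>" for t \<theta>
  define Uth where "Uth t \<theta> = Uh t \<theta> + exp t * cos \<theta> * Ah 1 t \<theta> + exp t * sin \<theta> * Ah 2 t \<theta>" for t \<theta>
  define Uhh where "Uhh t \<theta> = - Ut t \<theta> - exp t * sin \<theta> * Ah 1 t \<theta> + exp t * cos \<theta> * Ah 2 t \<theta>" for t \<theta>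
  define P where "P t \<theta> = p (pol t \<theta>)" for t \<theta>
  define Pt where "Pt t \<theta> = exp t * cos \<theta> * partial_deriv 1 p (pol t \<theta>)
      + exp t * sin \<theta> * partial_deriv 2 p (pol t \<theta>)" for t \<theta>

  have A: "((\<lambda>t. A i t \<theta>) has_real_derivative At i t \<theta>) (at t)"
      "((\<lambda>\<theta>. A i t \<theta>) has_real_derivative Ah i t \<theta>) (at \<theta>)" for i t \<theta>
    unfolding A_def At_def Ah_def H_def by (rule pol_derivatives[OF da])+
  have jA: "jcont (A i)" and jH: "jcont (H i j)" and jU: "jcont U" and jP: "jcont P"
    and jp: "jcont (\<lambda>t \<theta>. partial_deriv i p (pol t \<theta>))" for i j
    unfolding A_def[abs_def] H_def[abs_def] U_def[abs_def] P_def[abs_def]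
    by (intro jcont_pol cu cp)+
  note jc = jA[THEN jcont_compose] jH[THEN jcont_compose] jp[THEN jcont_compose]
  have jUt: "jcont Ut" and jUh: "jcont Uh" and jPt: "jcont Pt"
    unfolding Ut_def[abs_def] Uh_def[abs_def] Pt_def[abs_def]
    by (intro jcontI continuous_intros jc)+
  have jAt: "jcont (At i)" "jcont (Ah i)" for i
    unfolding At_def[abs_def] Ah_def[abs_def]
    by (intro jcontI continuous_intros jc)+
  note jc' = jUt[THEN jcont_compose] jUh[THEN jcont_compose] jAt[THEN jcont_compose]
  have jUtt: "jcont Utt" and jUht: "jcont Uht" and jUhh: "jcont Uhh"
    unfolding Utt_def[abs_def] Uht_def[abs_def] Uhh_def[abs_def]
    by (intro jcontI continuous_intros jc')+

  have dU: "((\<lambda>t. U t \<theta>) has_real_derivative Ut t \<theta>) (at t)"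
      "(U t has_real_derivative Uh t \<theta>) (at \<theta>)" for t \<theta>
    unfolding U_def[abs_def] Ut_def Uh_def A_def by (rule pol_derivatives[OF du])+
  have dUt: "((\<lambda>t. Ut t \<theta>) has_real_derivative Utt t \<theta>) (at t)"
      "(Ut t has_real_derivative Uth t \<theta>) (at \<theta>)" for t \<theta>
    unfolding Ut_def[abs_def] Utt_def Uth_def Uh_def
    by (auto intro!: derivative_eq_intros A simp: algebra_simps)
  have dUh: "((\<lambda>t. Uh t \<theta>) has_real_derivative Uht t \<theta>) (at t)"
      "(Uh t has_real_derivative Uhh t \<theta>) (at \<theta>)" for t \<theta>
    unfolding Uh_def[abs_def] Uht_def Uhh_def Ut_def
    by (auto intro!: derivative_eq_intros A simp: algebra_simps)
  \<comment> \<open>The chain rule yields two different expressions for the mixed derivative; the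
    locale wants a single function.\<close>
  have Uth: "Uth t \<theta> = Uht t \<theta>" for t \<theta>
    by (rule mixed_partials_eq[OF dU dUt(2) dUh(1) jUh jUht])

  let ?f = "\<lambda>x. \<bar>p x\<bar> * exp (2 * u x)"
  have "cylinder U Ut Uh Utt Uht Uhh P Pt C (integral\<^sup>L lborel ?f)"
  proof
    show "((\<lambda>t. P t \<theta>) has_real_derivative Pt t \<theta>) (at t)" for t \<theta>
      unfolding P_def Pt_def by (rule pol_derivatives[OF dp])
    show "U t (2*pi) = U t 0" "Ut t (2*pi) = Ut t 0" "Uh t (2*pi) = Uh t 0" for t
      by (simp_all add: U_def Ut_def Uh_def A_def pol_def)
    show "Pt t \<theta> \<le> 0" for t \<theta>
      using assms(3)[rule_format, of "pol t \<theta>"] by (simp add: Pt_def inner_2 grad_def)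
    show "Utt t \<theta> + Uhh t \<theta> = - (exp (2*t) * P t \<theta> * exp (2 * U t \<theta>))" for t \<theta>
    proof -
      \<comment> \<open>The first-order terms \<open>Ut\<close> and the mixed second derivatives
        cancel in the sum.\<close>
      have "Utt t \<theta> + Uhh t \<theta> = (exp t)\<^sup>2 * ((sin \<theta>)\<^sup>2 + (cos \<theta>)\<^sup>2) * (H 1 1 t \<theta> + H 2 2 t \<theta>)"
        unfolding Utt_def Uhh_def At_def Ah_def by (simp only: power2_eq_square) algebra
      also have "\<dots> = exp (2*t) * laplacian u (pol t \<theta>)"
        by (simp add: H_def laplacian_def sum_2 exp_double)
      also have "laplacian u (pol t \<theta>) = - (P t \<theta> * exp (2 * U t \<theta>))"
        using eq[of "pol t \<theta>"] by (simp add: P_def U_def)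
      finally show ?thesis by simp
    qed
    show "integral {0..T} (cint (\<lambda>t \<theta>. \<bar>exp (2*t) * P t \<theta> * exp (2 * U t \<theta>)\<bar>)) \<le> integral\<^sup>L lborel ?f"
      if "T \<ge> 0" for T
      using polar_mass_le[OF _ _ int that]
      by (simp add: P_def U_def abs_mult mult_ac continuous_intros cp cu)
  qed (use jU jUt jUh jUtt jUht jUhh jP jPt dU dUt dUh C in \<open>simp_all add: Uth U_def\<close>)
  then interpret cylinder U Ut Uh Utt Uht Uhh P Pt C "integral\<^sup>L lborel ?f" .

  obtain x0 where x0: "p x0 \<noteq> p 0" using assms(2) by metis
  have p_le: "p x \<le> p 0" for x
    using ray_mean_value[OF dp, of x] assms(3) by (smt (verit) mult_neg_pos)
  obtain y where "y \<bullet> grad p y \<noteq> 0" using ray_mean_value[OF dp, of x0] x0 by blast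
  moreover from this have "y \<noteq> 0" by auto
  then obtain t0 \<theta>0 where "y = pol t0 \<theta>0" "\<theta>0 \<in> {0..2*pi}" by (rule pol_surj)
  ultimately have nontrivial: "Pt t0 \<theta>0 \<noteq> 0" "\<theta>0 \<in> {0..2*pi}"
    by (auto simp: Pt_def inner_2 grad_def)

  obtain B1 B2 B3 where B: "\<And>t \<theta>. t \<le> 0 \<Longrightarrow> \<bar>A 1 t \<theta>\<bar> \<le> B1" "\<And>t \<theta>. t \<le> 0 \<Longrightarrow> \<bar>A 2 t \<theta>\<bar> \<le> B2"
    "\<And>t \<theta>. t \<le> 0 \<Longrightarrow> \<bar>P t \<theta>\<bar> \<le> B3"
    using bounded_near_origin[OF cu(2)[of 1]] bounded_near_origin[OF cu(2)[of 2]] bounded_near_origin[OF cp(1)]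
    unfolding A_def P_def by metis
  have Bpos: "B1 \<ge> 0" "B2 \<ge> 0" "B3 \<ge> 0" using B[of 0 0] by force+
  \<comment> \<open>The chain rule provides the factor \<open>exp t\<close>. The three bounds are
    added because \<open>contradiction\<close> takes one constant for both decay hypotheses.\<close>
  have decay: "\<bar>Ut t \<theta>\<bar> \<le> (B1 + B2 + B3) * exp t" if "t \<le> 0" for t \<theta>
  proof -
    have "\<bar>Ut t \<theta>\<bar> \<le> exp t * (\<bar>cos \<theta>\<bar> * \<bar>A 1 t \<theta>\<bar>) + exp t * (\<bar>sin \<theta>\<bar> * \<bar>A 2 t \<theta>\<bar>)"
      unfolding Ut_def by (rule order_trans[OF abs_triangle_ineq]) (simp add: abs_mult)
    also have "\<dots> \<le> exp t * (1 * B1) + exp t * (1 * B2)"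
      using that by (intro add_mono mult_left_mono mult_mono B) auto
    also have "\<dots> \<le> (B1 + B2 + B3) * exp t" using Bpos by (simp add: algebra_simps)
    finally show ?thesis .
  qed
  have decay': "\<bar>P t \<theta>\<bar> \<le> B1 + B2 + B3" if "t \<le> 0" for t \<theta>
    using B(3)[OF that, of \<theta>] Bpos by linarith
  obtain c t1 where "c > 0" "\<And>t. t \<ge> t1 \<Longrightarrow> c * exp (2*t) \<le> cint (\<lambda>t \<theta>. \<bar>P t \<theta>\<bar>) t"
    using circle_integral_growth[OF assms(1) p_le x0] unfolding P_def by blast
  with contradiction[OF decay decay' nontrivial] show False by blast
qed

end
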